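(* Let $G$ be a hyperbolic group with finite generating set $X$, and for $a\in G$ consider $X$ as a generating set for the quotient $Q_a:=G/\langle\langle a\rangle\rangle$. Then, for each element of infinite order $a\in G$, there exist constants $K,N$ (with $K$ an integer) with the following property: for every $h\in G$, if $d_G(1,h)=d_{Q_a}(\langle\langle a\rangle\rangle,\,h\langle\langle a\rangle\rangle)>N$, then $ha^K\in G$ is not a proper power.
   Context: $\langle\langle a\rangle\rangle$ denotes the normal closure of $a$ in $G$. $d_G$ and $d_{Q_a}$ denote the word metrics on $G$ and $Q_a$ with respect to $X$ (respectively, the image of $X$ in $Q_a$); thus $d_{Q_a}(\langle\langle a\rangle\rangle,h\langle\langle a\rangle\rangle)$ is the distance in $Q_a$ from the identity to the image of $h$. An element of $G$ is a proper power if it equals $g^p$ for some $g\in G$ and some integer $p\ge 2$. *)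

theory Defs
  imports Complex_Main "HOL-Algebra.Coset" "HOL-Algebra.Generated_Groups"
begin

definition finite_generating_set :: "('a, 'b) monoid_scheme \<Rightarrow> 'a set \<Rightarrow> bool" where
  "finite_generating_set G X \<longleftrightarrow>
     finite X \<and> X \<subseteq> carrier G \<and> generate G X = carrier G"

definition word_value :: "('a, 'b) monoid_scheme \<Rightarrow> 'a list \<Rightarrow> 'a" where
  "word_value G w = foldr (\<lambda>x y. x \<otimes>\<^bsub>G\<^esub> y) w \<one>\<^bsub>G\<^esub>"

(* Meaningful only if X generates G: otherwise the LEAST may range over the empty set. *)
definition word_dist :: "('a, 'b) monoid_scheme \<Rightarrow> 'a set \<Rightarrow> 'a \<Rightarrow> 'a \<Rightarrow> nat" where
  "word_dist G X g h =
     (LEAST n. \<exists>w. length w = n \<and> set w \<subseteq> X \<union> m_inv G ` X \<and>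
                   word_value G w = inv\<^bsub>G\<^esub> g \<otimes>\<^bsub>G\<^esub> h)"

definition gromov_product :: "('a \<Rightarrow> 'a \<Rightarrow> real) \<Rightarrow> 'a \<Rightarrow> 'a \<Rightarrow> 'a \<Rightarrow> real" where
  "gromov_product d w x y = (d w x + d w y - d x y) / 2"

definition gromov_hyperbolic_on :: "'a set \<Rightarrow> ('a \<Rightarrow> 'a \<Rightarrow> real) \<Rightarrow> bool" where
  "gromov_hyperbolic_on S d \<longleftrightarrow>
     (\<exists>\<delta>. \<forall>w\<in>S. \<forall>x\<in>S. \<forall>y\<in>S. \<forall>z\<in>S.
        gromov_product d w x z \<ge>
          min (gromov_product d w x y) (gromov_product d w y z) - \<delta>)"

(* Gromov's definition: the group itself, with the word metric of some finite generating set,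
   is a hyperbolic metric space (rather than slim triangles in the Cayley graph). *)
definition hyperbolic_group :: "('a, 'b) monoid_scheme \<Rightarrow> bool" where
  "hyperbolic_group G \<longleftrightarrow>
     group G \<and>
     (\<exists>S. finite_generating_set G S \<and>
          gromov_hyperbolic_on (carrier G) (\<lambda>g h. real (word_dist G S g h)))"

definition normal_closure :: "('a, 'b) monoid_scheme \<Rightarrow> 'a \<Rightarrow> 'a set" where
  "normal_closure G a = \<Inter> {N. N \<lhd> G \<and> a \<in> N}"

definition infinite_order :: "('a, 'b) monoid_scheme \<Rightarrow> 'a \<Rightarrow> bool" where
  "infinite_order G a \<longleftrightarrow> (\<forall>n::nat. n > 0 \<longrightarrow> a [^]\<^bsub>G\<^esub> n \<noteq> \<one>\<^bsub>G\<^esub>)"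

definition proper_power :: "('a, 'b) monoid_scheme \<Rightarrow> 'a \<Rightarrow> bool" where
  "proper_power G x \<longleftrightarrow> (\<exists>g\<in>carrier G. \<exists>p::int. p \<ge> 2 \<and> x = g [^]\<^bsub>G\<^esub> p)"

(* Distance in G Mod <<a>>, with respect to the image of X, from the identity coset to the
   coset of h. *)
definition quotient_length ::
  "('a, 'b) monoid_scheme \<Rightarrow> 'a set \<Rightarrow> 'a \<Rightarrow> 'a \<Rightarrow> nat" where
  "quotient_length G X a h =
     word_dist (G Mod normal_closure G a) ((\<lambda>x. x <#\<^bsub>G\<^esub> normal_closure G a) ` X)
       (normal_closure G a) (h <#\<^bsub>G\<^esub> normal_closure G a)"

end

theory Submission
  imports Defs
begin

text \<open>
  Let \<open>N\<close> be the normal closure of \<open>a\<close>. The hypothesis on \<open>h\<close> says that \<open>h\<close> is a shortest element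
  of its coset \<open>h N\<close>. Every translate \<open>v \<langle>a\<rangle>\<close> lies in a single coset of \<open>N\<close>, so if a geodesic to \<open>h\<close>
  came close to such a translate at two points far apart, a detour through the translate, which is
  free modulo \<open>N\<close>, would shorten \<open>h\<close> within its coset. Hence the geodesic to \<open>h\<close> stays near each
  translate of \<open>\<langle>a\<rangle>\<close> for a bounded length only (\<open>shortest_mod_near_coset_bounded\<close>).

  In a hyperbolic group the powers of \<open>a\<close> form a quasi-line (\<open>infinite_order_quasi_line\<close>). The
  bounded overlap makes the turns between \<open>h\<close> and \<open>a\<^sup>K\<close> blunt, with a bound that does not depend on
  \<open>K\<close>; when \<open>h\<close> and \<open>a\<^sup>K\<close> are long, the broken line through the points \<open>u\<^sup>i\<close> and \<open>u\<^sup>i h\<close>, where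
  \<open>u = h a\<^sup>K\<close>, is therefore a quasi-line as well (\<open>zigzag_quasi_line\<close>).

  Suppose now that \<open>u = g\<^sup>p\<close> with \<open>p \<ge> 2\<close>. As \<open>g\<close> commutes with \<open>u\<close>, it moves the line of \<open>u\<close> to itself
  up to a bounded error (\<open>commuting_preserves_zigzag\<close>), so the translate by \<open>g\<close> of the segment from
  \<open>a\<^sup>-\<^sup>K\<close> to \<open>1\<close> runs along the line. It is short compared with \<open>h\<close>, hence meets only a bounded number
  of the segments of the line, and it is long compared with all other constants, hence it follows
  one of them for a long time. That segment cannot be a translate of the one to \<open>h\<close>, by the bounded
  overlap; so it is a translate by some \<open>u\<^sup>i\<close> of the segment of powers of \<open>a\<close>. By the pigeonhole
  principle \<open>g\<^sup>-\<^sup>1 u\<^sup>i\<close> then conjugates some nonzero power of \<open>a\<close> to another one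
  (\<open>root_commensurates\<close>).

  Here \<open>g\<^sup>-\<^sup>1 u\<^sup>i\<close> is the power of \<open>g\<close> with exponent \<open>q = p i - 1\<close>, and \<open>q \<noteq> 0\<close> because \<open>p \<ge> 2\<close>. Its \<open>p\<close>-th power
  \<open>u\<^sup>q\<close> also conjugates nonzero powers of \<open>a\<close> to each other, and so it lies near \<open>\<langle>a\<rangle>\<close>
  (\<open>commensurating_near_power\<close>). The line of \<open>u\<close> passes through \<open>h\<close> on the way from \<open>1\<close> to \<open>u\<close> raised to
  the power \<open>\<bar>q\<bar>\<close>, which puts both \<open>1\<close> and \<open>h\<close> near \<open>\<langle>a\<rangle>\<close>; by the bounded overlap \<open>h\<close> is short.

  The element \<open>h\<close> is shortest for the metric of \<open>X\<close>, whereas hyperbolicity is given for another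
  generating set. The two metrics are bi-Lipschitz equivalent, and geodesics of the hyperbolic one
  follow bi-Lipschitz paths (\<open>geodesic_near_path\<close>); this half of the Morse lemma suffices to
  compare them.
\<close>

section \<open>Gromov products and quasi-lines\<close>

locale hyperbolic_space =
  fixes d :: "'p \<Rightarrow> 'p \<Rightarrow> real" and \<delta> :: real
  assumes dist_self: "d x x = 0"
    and dist_sym: "d x y = d y x"
    and dist_tri: "d x z \<le> d x y + d y z"
    and four_point: "gromov_product d w x z \<ge>
          min (gromov_product d w x y) (gromov_product d w y z) - \<delta>"
begin

abbreviation gp :: "'p \<Rightarrow> 'p \<Rightarrow> 'p \<Rightarrow> real" where
  "gp \<equiv> gromov_product d"

lemmas gp_def = gromov_product_def[of d]

lemma dist_nonneg: "0 \<le> d x y"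
  using dist_tri[of x x y] dist_self[of x] dist_sym[of x y] by linarith

lemma delta_nonneg: "0 \<le> \<delta>"
  using four_point[of undefined undefined undefined undefined] by (simp add: gp_def dist_self)

lemma gp_commute: "gp w x y = gp w y x"
  by (simp add: gp_def dist_sym)

lemma gp_add: "gp x y z + gp y x z = d x y"
  using dist_sym[of x y] by (simp add: gp_def field_simps)

lemma gp_ge: "d w x - d x y \<le> gp w x y"
  using dist_tri[of w x y] dist_tri[of w y x] dist_sym[of x y] 
  by (simp add: gp_def field_simps)

lemma gp_nonneg: "0 \<le> gp w x y"
  using dist_tri[of x y w] dist_sym[of x w] dist_sym[of y w] by (simp add: gp_def)

lemma gp_le_dist: "gp w x y \<le> d w x"
  using dist_tri[of w y x] by (simp add: gp_def field_simps)

lemma gp_move_left: "gp w x' y \<le> gp w x y + d x x'"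
  using dist_tri[of w x' x] dist_tri[of x y x'] by (simp add: gp_def field_simps)

lemma gp_move_right: "gp w x y' \<le> gp w x y + d y y'"
  using gp_move_left[of w y' x y] by (simp add: gp_commute)

lemma gp_move_base: "gp w' x y \<le> gp w x y + d w w'"
  using dist_tri[of w' x w] dist_tri[of w' y w] dist_sym[of w w'] by (simp add: gp_def field_simps)

lemma four_point_two_steps:
  "min (gp w x x') (min (gp w x' z') (gp w z' z)) - 2 * \<delta> \<le> gp w x z"
  using four_point[of w x x' z] four_point[of w x' z' z] delta_nonneg by linarith

lemma four_point_sums:
  "d x z + d y w \<le> max (d x y + d z w) (d x w + d y z) + 2 * \<delta>"
proof -
  have "min (gp w x y) (gp w y z) - \<delta> \<le> gp w x z" by (rule four_point)
  then show ?thesis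
    using dist_sym[of w x] dist_sym[of w y] dist_sym[of w z]
    by (auto simp: gp_def min_def max_def field_simps split: if_splits)
qed

text \<open>Moving both endpoints of a segment by amounts that are small compared with their distance
  from \<open>y\<close> is invisible from \<open>y\<close>, up to \<open>2\<delta>\<close>. This is how two lines with the same points at
  infinity are compared without a boundary.\<close>

lemma gp_far_endpoints:
  assumes "gp y x z \<le> C" "d y x - d x x' > C + 2 * \<delta>" "d y z - d z z' > C + 2 * \<delta>"
  shows "gp y x' z' \<le> C + 2 * \<delta>"
proof -
  have "gp y x x' > C + 2 * \<delta>" using gp_ge[of y x x'] assms(2) by linarith
  moreover have "gp y z' z > C + 2 * \<delta>" using gp_ge[of y z z'] assms(3) gp_commute[of y z z'] by linarith
  ultimately show ?thesis using four_point_two_steps[of y x x' z' z] assms(1) by linarith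
qed

text \<open>Geodesics from \<open>p\<close> to \<open>h\<close> and to \<open>y\<close> run together up to distance \<open>gp p h y\<close> from \<open>p\<close>, so a point \<open>z\<close>
  on the first one within that distance is almost on the second one.\<close>

lemma gp_initial_segment:
  assumes "gp z p h = 0" "d p z \<le> gp p h y"
  shows "gp z p y \<le> \<delta>"
proof -
  have "gp p z h = d p z" using gp_add[of z p h] assms(1) dist_sym[of p z] by simp
  then have "gp p z y \<ge> d p z - \<delta>" using four_point[of p z h y] assms(2) by linarith
  then show ?thesis using gp_add[of z p y] dist_sym[of p z] by linarith
qed

text \<open>A discrete quasi-geodesic line, in a form that needs no parametrization: each point lies, up to
  \<open>C\<close>, between the earlier and the later ones.\<close>

definition quasi_line :: "(int \<Rightarrow> 'p) \<Rightarrow> real \<Rightarrow> bool" where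
  "quasi_line x C \<longleftrightarrow> (\<forall>i j k. i \<le> j \<longrightarrow> j \<le> k \<longrightarrow> gp (x j) (x i) (x k) \<le> C)"

lemma quasi_lineD: "quasi_line x C \<Longrightarrow> i \<le> j \<Longrightarrow> j \<le> k \<Longrightarrow> gp (x j) (x i) (x k) \<le> C"
  by (auto simp: quasi_line_def)

lemma quasi_line_nonneg: "quasi_line x C \<Longrightarrow> 0 \<le> C"
  using quasi_lineD[of x C 0 0 0] gp_nonneg[of "x 0" "x 0" "x 0"] by linarith

lemma quasi_line_dist:
  assumes "quasi_line x C" "i \<le> j" "j \<le> k"
  shows "d (x i) (x j) + d (x j) (x k) - 2 * C \<le> d (x i) (x k)"
  using quasi_lineD[OF assms] dist_sym[of "x i" "x j"] by (simp add: gp_def)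

text \<open>Seen from the next point, the start of the chain lies in the direction of the current
  point, because the step between the two is long; hence the next turn, which is measured against
  the current point, is equally blunt when measured against the start.\<close>

lemma chain_forward:
  fixes x :: "int \<Rightarrow> 'p"
  assumes turn: "\<And>i. gp (x i) (x (i - 1)) (x (i + 1)) \<le> C"
    and step: "\<And>i. d (x i) (x (i + 1)) > 2 * C + 3 * \<delta>"
    and "i < j"
  shows "gp (x j) (x i) (x (j + 1)) \<le> C + \<delta>"
  using \<open>i < j\<close>
proof (induction j rule: int_gr_induct)
  case base
  show ?case using turn[of "i + 1"] delta_nonneg by simp
next
  case (step j)
  have a: "gp (x (j+1)) (x j) (x (j+2)) \<le> C" using turn[of "j+1"] by (simp add: add.commute)
  have "gp (x (j+1)) (x j) (x i) = d (x j) (x (j+1)) - gp (x j) (x i) (x (j+1))"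
    using gp_add[of "x j" "x (j+1)" "x i"] gp_commute[of "x j"] by (simp add: field_simps)
  then have "gp (x (j+1)) (x j) (x i) > C + \<delta>"
    using assms(2)[of j] step.IH delta_nonneg by linarith
  then show ?case using four_point[of "x (j+1)" "x j" "x i" "x (j+2)"] a by (simp add: add.commute)
qed

text \<open>Local-to-global: if Gromov products at consecutive points are at most \<open>C\<close> and the steps are long
  compared with \<open>C\<close> and \<open>\<delta>\<close>, the chain never turns back.\<close>

lemma chain_quasi_line:
  fixes x :: "int \<Rightarrow> 'p"
  assumes turn: "\<And>i. gp (x i) (x (i - 1)) (x (i + 1)) \<le> C"
    and step: "\<And>i. d (x i) (x (i + 1)) > 2 * C + 3 * \<delta>"
  shows "quasi_line x (C + 2 * \<delta>)"
proof -
  have C0: "0 \<le> C" using turn[of 0] gp_nonneg order_trans by blast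
  have fwd: "gp (x j) (x i) (x (j + 1)) \<le> C + \<delta>" if "i < j" for i j
    by (rule chain_forward[OF turn step that])
  have bwd: "gp (x j) (x (j - 1)) (x k) \<le> C + \<delta>" if "j < k" for j k
  proof -
    (* The chain traversed backwards. *)
    have t: "gp (x (- i)) (x (- (i - 1))) (x (- (i + 1))) \<le> C" for i
      using turn[of "-i"] gp_commute[of "x (-i)"] by simp
    have s: "d (x (- i)) (x (- (i + 1))) > 2 * C + 3 * \<delta>" for i
      using step[of "-i-1"] dist_sym[of "x (-i)"] by simp
    show ?thesis
      using chain_forward[of "\<lambda>i. x (-i)" C "-k" "-j", OF t s] that gp_commute[of "x j"] by simp
  qed
  have "gp (x j) (x i) (x k) \<le> C + 2 * \<delta>" if "i < j" "j < k" for i j k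
  proof -
    have "gp (x (j+1)) (x j) (x k) \<le> C + \<delta>"
    proof (cases "j + 1 < k")
      case True then show ?thesis using bwd[of "j+1" k] by simp
    next
      case False
      then have "k = j + 1" using that by simp
      then show ?thesis
        using dist_self[of "x k"] dist_sym[of "x j" "x k"] C0 delta_nonneg by (simp add: gp_def)
    qed
    then have "gp (x j) (x k) (x (j+1)) > C + 2 * \<delta>"
      using gp_add[of "x j" "x (j+1)" "x k"] gp_commute[of "x j"] step[of j] by simp
    then show ?thesis using four_point[of "x j" "x i" "x k" "x (j+1)"] gp_commute[of "x j" "x k"] fwd[OF that(1)] by linarith
  qed
  moreover have "gp w w z = 0" "gp w z w = 0" for w z
    using dist_self[of w] dist_sym[of w z] by (auto simp: gp_def)
  ultimately show ?thesis
    unfolding quasi_line_def using C0 delta_nonneg by (auto simp: order.order_iff_strict)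
qed

lemma quasi_line_close:
  assumes "quasi_line x C" "mono f" and close: "\<And>i. d (x (f i)) (x' i) \<le> E"
  shows "quasi_line x' (C + 3 * E)"
  unfolding quasi_line_def
proof (intro allI impI)
  fix i j k :: int assume "i \<le> j" "j \<le> k"
  then have "gp (x (f j)) (x (f i)) (x (f k)) \<le> C"
    using assms(1,2) by (auto intro!: quasi_lineD dest: monoD)
  then show "gp (x' j) (x' i) (x' k) \<le> C + 3 * E"
    using gp_move_base[of "x' j" "x (f i)" "x (f k)" "x (f j)"]
      gp_move_left[of "x' j" "x' i" "x (f k)" "x (f i)"]
      gp_move_right[of "x' j" "x' i" "x' k" "x (f k)"] close[of i] close[of j] close[of k]
    by linarith
qed

text \<open>Walking along the line, the Gromov product of the starting point and the current point,
  seen from \<open>y\<close>, drops below its final value plus \<open>\<delta>\<close> during one step; this is the step that passes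
  \<open>y\<close>.\<close>

lemma quasi_line_passes:
  assumes ql: "quasi_line x C" and "i < k" and near: "gp y (x i) (x k) \<le> C'"
  obtains j where "i \<le> j" "j < k" "gp y (x j) (x (j + 1)) \<le> 2 * C' + C + 2 * \<delta>"
proof -
  have C0: "0 \<le> C" by (rule quasi_line_nonneg[OF ql])
  have C'0: "0 \<le> C'" using near gp_nonneg[of y "x i" "x k"] by linarith
  have "gp y (x i) (x k) \<le> C' + \<delta>" using near delta_nonneg by linarith
  with \<open>i < k\<close> have "\<exists>j. i \<le> j \<and> j < k \<and> gp y (x i) (x (j + 1)) \<le> C' + \<delta> \<and>
     (j = i \<or> gp y (x i) (x j) > C' + \<delta>)"
  proof (induction k rule: int_gr_induct)
    case base
    then show ?case by (intro exI[of _ i]) auto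
  next
    case (step m)
    show ?case
    proof (cases "gp y (x i) (x m) \<le> C' + \<delta>")
      case True
      then obtain j where "i \<le> j" "j < m" "gp y (x i) (x (j + 1)) \<le> C' + \<delta>"
        "j = i \<or> gp y (x i) (x j) > C' + \<delta>" using step.IH by blast
      then show ?thesis by (intro exI[of _ j]) auto
    next
      case False
      then show ?thesis using step by (intro exI[of _ m]) auto
    qed
  qed
  then obtain j where j: "i \<le> j" "j < k" "gp y (x i) (x (j + 1)) \<le> C' + \<delta>"
    "j = i \<or> gp y (x i) (x j) > C' + \<delta>" by blast
  show thesis
  proof (cases "j = i")
    case True
    then show ?thesis using j C0 C'0 delta_nonneg by (intro that[of j]) auto
  next
    case False
    then have "gp y (x j) (x k) \<le> C' + \<delta>"
      using j(4) four_point[of y "x i" "x j" "x k"] near by linarith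
    moreover have "d (x i) (x j) + d (x j) (x k) - 2 * C \<le> d (x i) (x k)"
      using quasi_line_dist[OF ql] j by simp
    ultimately have "gp y (x j) (x (j + 1)) \<le> 2 * C' + C + 2 * \<delta>"
      using j(3) dist_tri[of "x i" "x (j+1)" "x j"] dist_tri[of "x i" "x k" y] dist_sym[of y "x i"]
      unfolding gp_def by (simp add: field_simps)
    then show ?thesis using j by (intro that[of j])
  qed
qed

lemma quasi_line_between:
  assumes ql: "quasi_line x C" and "i \<le> j" "j \<le> k" "k \<le> l" and w: "gp w (x j) (x k) \<le> C'"
  shows "gp w (x i) (x l) \<le> C' + 2 * C"
proof -
  have "d (x i) (x j) + d (x j) (x l) - 2 * C \<le> d (x i) (x l)"
    "d (x j) (x k) + d (x k) (x l) - 2 * C \<le> d (x j) (x l)"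
    using quasi_line_dist[OF ql] assms by simp_all
  then show ?thesis
    using w dist_tri[of w "x i" "x j"] dist_tri[of w "x l" "x k"] dist_sym[of "x i" "x j"]
    unfolding gp_def by (simp add: field_simps)
qed

text \<open>Two points that are close to segments of the line are at least as far apart as the part of
  the line between these segments.\<close>

lemma quasi_line_separates:
  assumes ql: "quasi_line x C" and "i \<le> j" "j \<le> k" "k \<le> l"
    and y: "gp y (x i) (x j) \<le> C'" and z: "gp z (x k) (x l) \<le> C'"
  shows "d (x j) (x k) \<le> d y z + 2 * C' + 2 * C"
proof -
  have "d (x i) (x j) + d (x j) (x l) - 2 * C \<le> d (x i) (x l)"
    "d (x j) (x k) + d (x k) (x l) - 2 * C \<le> d (x j) (x l)"
    using quasi_line_dist[OF ql] assms by simp_all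
  then show ?thesis
    using y z dist_tri[of "x i" "x l" y] dist_tri[of y "x l" z] dist_tri[of "x j" "x k" y]
      dist_tri[of y "x k" z] dist_sym[of y "x i"] dist_sym[of y "x j"]
    unfolding gp_def by (simp add: field_simps)
qed

lemma quasi_line_inner_dist:
  assumes ql: "quasi_line x C" and "i \<le> j" "j \<le> k" "k \<le> l"
  shows "d (x j) (x k) \<le> d (x i) (x l) + 4 * C"
  using quasi_line_dist[OF ql, of i j l] quasi_line_dist[OF ql, of j k l] assms
    dist_nonneg[of "x i" "x j"] dist_nonneg[of "x k" "x l"] by simp

lemma quasi_line_escapes:
  assumes ql: "quasi_line x C" and step: "\<And>i. d (x i) (x (i + 1)) \<ge> 2 * C + 1"
  shows "real n \<le> d (x i) (x (i + int n))"
proof (induction n)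
  case 0 show ?case by (simp add: dist_nonneg)
next
  case (Suc n)
  have "d (x i) (x (i + int n)) + d (x (i + int n)) (x (i + int n + 1)) - 2 * C \<le> d (x i) (x (i + int n + 1))"
    using quasi_line_dist[OF ql] by simp
  then show ?case using Suc step[of "i + int n"] by (simp add: algebra_simps)
qed

section \<open>Geodesics follow bi-Lipschitz paths\<close>

text \<open>The four-point inequality, applied to the midpoint of the path over and over again, costs \<open>\<delta>\<close> per
  halving. So a path around \<open>w\<close>, whose endpoints have a small product at \<open>w\<close>, is exponentially long in the
  distance \<open>m\<close> that it keeps from \<open>w\<close>.\<close>

lemma gp_path_log:
  assumes "\<And>i. i < n \<Longrightarrow> m \<le> gp w (c i) (c (Suc i))" "\<And>i. i \<le> n \<Longrightarrow> m \<le> d w (c i)"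
    and "i \<le> j" "j \<le> n" "j - i \<le> 2 ^ k"
  shows "m - real k * \<delta> \<le> gp w (c i) (c j)"
  using assms(3-5)
proof (induction k arbitrary: i j)
  case 0
  then consider "j = i" | "j = Suc i" by force
  then show ?case
  proof cases
    case 1
    then show ?thesis using assms(2)[of i] 0 by (simp add: gp_def dist_self)
  next
    case 2
    then show ?thesis using assms(1)[of i] 0 by simp
  qed
next
  case (Suc k)
  define l where "l = i + (j - i) div 2"
  have "i \<le> l" "l \<le> j" "l - i \<le> 2 ^ k" "j - l \<le> 2 ^ k" using Suc.prems by (auto simp: l_def)
  then have "m - real k * \<delta> \<le> gp w (c i) (c l)" "m - real k * \<delta> \<le> gp w (c l) (c j)"
    using Suc.IH[of i l] Suc.IH[of l j] Suc.prems by auto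
  then show ?case using four_point[of w "c i" "c l" "c j"] by (simp add: algebra_simps)
qed

end

lemma exp_beats_linear:
  fixes A B :: real
  obtains k\<^sub>0 :: nat where "\<And>k. 2 ^ k \<le> A + B * real k \<Longrightarrow> k \<le> k\<^sub>0"
proof -
  have "(\<lambda>k. (A + B * real k) / 2 ^ k) \<longlonglongrightarrow> 0"
  proof -
    have "(\<lambda>k. A * (1/2) ^ k + B * (real k * (1/2) ^ k)) \<longlonglongrightarrow> A * 0 + B * 0"
      by (intro tendsto_intros LIMSEQ_realpow_zero powser_times_n_limit_0) auto
    then show ?thesis by (simp add: field_simps power_divide)
  qed
  then have "\<forall>\<^sub>F k in sequentially. (A + B * real k) / 2 ^ k < 1"
    by (rule order_tendstoD) simp
  then obtain k\<^sub>0 where "\<And>k. k \<ge> k\<^sub>0 \<Longrightarrow> A + B * real k < 2 ^ k"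
    by (auto simp: eventually_sequentially field_simps)
  then show thesis by (intro that[of k\<^sub>0]) (force simp: not_less[symmetric])
qed

context hyperbolic_space begin

text \<open>Take the point \<open>y\<close> of the geodesic that is farthest from the path, at distance \<open>M\<close>, and two points
  of the geodesic at distance about \<open>2 M\<close> from \<open>y\<close> on either side. They are within \<open>M\<close> of the path, and
  the piece of the path between their neighbours joins the two sides of \<open>y\<close> outside the ball of
  radius \<open>M\<close>. Its number of steps is at most linear in \<open>M\<close> by the bi-Lipschitz condition, but
  exponential in \<open>M\<close> by \<open>gp_path_log\<close>; so \<open>M\<close> is bounded.\<close>

lemma geodesic_near_path:
  fixes L \<Lambda> :: real
  assumes "0 \<le> L" "0 \<le> \<Lambda>"
  obtains D where "\<And>(c :: nat \<Rightarrow> 'p) n \<gamma> m r. \<lbrakk>\<gamma> 0 = c 0; \<gamma> m = c n;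
      \<And>i j. i \<le> j \<Longrightarrow> j \<le> m \<Longrightarrow> d (\<gamma> i) (\<gamma> j) = real (j - i);
      \<And>i. i < n \<Longrightarrow> d (c i) (c (Suc i)) \<le> L;
      \<And>i j. i \<le> j \<Longrightarrow> j \<le> n \<Longrightarrow> real (j - i) \<le> \<Lambda> * d (c i) (c j); r \<le> m\<rbrakk>
      \<Longrightarrow> \<exists>i\<le>n. d (\<gamma> r) (c i) \<le> D"
proof -
  define A B where "A = 2 * \<Lambda> * (6 * (L + 2 * \<delta>) + 6 * \<delta> + 2)" and "B = 12 * \<Lambda> * \<delta>"
  obtain k\<^sub>0 where k0: "\<And>k. 2 ^ k \<le> A + B * real k \<Longrightarrow> k \<le> k\<^sub>0" using exp_beats_linear by blast
  show thesis
  proof (rule that[of "L + 2 * \<delta> + real (Suc k\<^sub>0) * \<delta>"])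
    fix c :: "nat \<Rightarrow> 'p" and n \<gamma> m r
    assume ends: "\<gamma> 0 = c 0" "\<gamma> m = c n"
      and geo: "\<And>i j. i \<le> j \<Longrightarrow> j \<le> m \<Longrightarrow> d (\<gamma> i) (\<gamma> j) = real (j - i)"
      and lip: "\<And>i. i < n \<Longrightarrow> d (c i) (c (Suc i)) \<le> L"
      and colip: "\<And>i j. i \<le> j \<Longrightarrow> j \<le> n \<Longrightarrow> real (j - i) \<le> \<Lambda> * d (c i) (c j)"
      and "r \<le> m"
    define f where "f r = Min ((\<lambda>i. d (\<gamma> r) (c i)) ` {..n})" for r
    have f_le: "f r \<le> d (\<gamma> r) (c i)" if "i \<le> n" for r i using that by (simp add: f_def)
    have f_att: "\<exists>i\<le>n. d (\<gamma> r) (c i) = f r" for r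
    proof -
      have "f r \<in> (\<lambda>i. d (\<gamma> r) (c i)) ` {..n}" unfolding f_def by (rule Min_in) auto
      then show ?thesis by auto
    qed
    define M where "M = Max (f ` {..m})"
    have f_M: "f r \<le> M" if "r \<le> m" for r using that by (simp add: M_def)
    have "M \<in> f ` {..m}" unfolding M_def by (rule Max_in) auto
    then obtain q where q: "q \<le> m" "f q = M" by auto
    define y where "y = \<gamma> q"
    have far: "M \<le> d y (c i)" if "i \<le> n" for i using f_le[OF that, of q] q by (simp add: y_def)
    have M0: "0 \<le> M" using f_att[of q] q dist_nonneg by metis
    define e where "e = nat \<lceil>2 * M\<rceil>"
    have e: "2 * M \<le> real e" "real e \<le> 2 * M + 1" using M0 unfolding e_def by linarith+
    (* When the geodesic is too short to go 2 M away from y, its endpoint, which is on the path,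
       takes the place of the point of the geodesic and of its neighbour on the path. *)
    have left: "\<exists>s\<le>n. d (\<gamma> (q - e)) (c s) \<le> M \<and> M \<le> gp y (\<gamma> (q - e)) (c s)"
    proof (cases "q < e")
      case True
      then show ?thesis using ends(1) far[of 0] M0 by (intro exI[of _ 0]) (auto simp: gp_def dist_self)
    next
      case False
      obtain s where s: "s \<le> n" "d (\<gamma> (q - e)) (c s) = f (q - e)" using f_att by blast
      then have "d (\<gamma> (q - e)) (c s) \<le> M" using f_M[of "q - e"] q by simp
      moreover have "d y (\<gamma> (q - e)) = real e"
        using geo[of "q - e" q] q False dist_sym[of y] by (simp add: y_def)
      ultimately show ?thesis
        using s(1) gp_ge[of y "\<gamma> (q - e)" "c s"] e by (intro exI[of _ s]) auto
    qed
    have right: "\<exists>t\<le>n. d (\<gamma> (min m (q + e))) (c t) \<le> M \<and> M \<le> gp y (\<gamma> (min m (q + e))) (c t)"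
    proof (cases "m < q + e")
      case True
      then show ?thesis using ends(2) far[of n] M0 by (intro exI[of _ n]) (auto simp: gp_def dist_self)
    next
      case False
      obtain s where s: "s \<le> n" "d (\<gamma> (q + e)) (c s) = f (q + e)" using f_att by blast
      then have "d (\<gamma> (q + e)) (c s) \<le> M" using f_M[of "q + e"] False by simp
      moreover have "d y (\<gamma> (q + e)) = real e"
        using geo[of q "q + e"] q False by (simp add: y_def)
      ultimately show ?thesis
        using s(1) gp_ge[of y "\<gamma> (q + e)" "c s"] e False by (intro exI[of _ s]) auto
    qed
    define P Q where "P = \<gamma> (q - e)" and "Q = \<gamma> (min m (q + e))"
    from left right obtain s t where s: "s \<le> n" "d P (c s) \<le> M" "M \<le> gp y P (c s)"
      and t: "t \<le> n" "d Q (c t) \<le> M" "M \<le> gp y Q (c t)" by (auto simp: P_def Q_def)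
    have PQ: "d P Q = d P y + d y Q" "d P y \<le> real e" "d y Q \<le> real e"
    proof -
      have "q - e \<le> q" "q \<le> min m (q + e)" "min m (q + e) \<le> m" using q by auto
      then have "d P y = real (q - (q - e))" "d y Q = real (min m (q + e) - q)"
        "d P Q = real (min m (q + e) - (q - e))"
        unfolding P_def Q_def y_def using q(1) by (auto simp del: of_nat_diff intro!: geo)
      moreover have "min m (q + e) - (q - e) = (q - (q - e)) + (min m (q + e) - q)"
        "q - (q - e) \<le> e" "min m (q + e) - q \<le> e" using q(1) by auto
      ultimately show "d P Q = d P y + d y Q" "d P y \<le> real e" "d y Q \<le> real e"
        by (simp_all only: of_nat_add of_nat_le_iff)
    qed
    then have "gp y P Q = 0" using dist_sym[of P y] by (simp add: gp_def)
    then have "min (gp y P (c s)) (min (gp y (c s) (c t)) (gp y (c t) Q)) \<le> 2 * \<delta>"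
      using four_point_two_steps[of y P "c s" "c t" Q] by linarith
    then have key: "M \<le> 2 * \<delta> \<or> gp y (c s) (c t) \<le> 2 * \<delta>"
      using s t gp_commute[of y Q] by (auto simp: min_def split: if_splits)
    have dst: "d (c s) (c t) \<le> 6 * M + 2"
      using dist_tri[of "c s" "c t" P] dist_tri[of P "c t" Q] s t PQ e dist_sym[of "c s" P] by linarith
    define N where "N = (if s \<le> t then t - s else s - t)"
    have N: "real N \<le> \<Lambda> * (6 * M + 2)"
    proof -
      have "real N \<le> \<Lambda> * d (c s) (c t)"
        using colip[of s t] colip[of t s] s t dist_sym[of "c s" "c t"] by (auto simp: N_def)
      then show ?thesis using dst mult_left_mono[OF dst \<open>0 \<le> \<Lambda>\<close>] by linarith
    qed
    have gp_st: "M - L - real k * \<delta> \<le> gp y (c s) (c t)" if "N \<le> 2 ^ k" for k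
    proof -
      have c1: "M - L \<le> gp y (c i) (c (Suc i))" if "i < n" for i
        using gp_ge[of y "c i" "c (Suc i)"] far[of i] lip[of i] that by linarith
      have c2: "M - L \<le> d y (c i)" if "i \<le> n" for i using far[OF that] \<open>0 \<le> L\<close> by linarith
      show ?thesis
        using gp_path_log[of n "M - L" y c s t k, OF c1 c2]
          gp_path_log[of n "M - L" y c t s k, OF c1 c2] that s t gp_commute[of y "c s" "c t"]
        by (cases "s \<le> t") (auto simp: N_def)
    qed
    define k where "k = (LEAST k. N \<le> 2 ^ k)"
    have Nk: "N \<le> 2 ^ k" unfolding k_def by (rule LeastI[of _ N]) (rule less_imp_le[OF less_exp])
    have Mk: "M \<le> L + 2 * \<delta> + real k * \<delta>"
      using key gp_st[OF Nk] \<open>0 \<le> L\<close> mult_nonneg_nonneg[of "real k" \<delta>] delta_nonneg by linarith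
    have "k \<le> Suc k\<^sub>0"
    proof (cases k)
      case (Suc k')
      then have "\<not> N \<le> 2 ^ k'" using not_less_Least[of k' "\<lambda>k. N \<le> 2 ^ k"] by (simp add: k_def)
      then have "real (2 ^ k') \<le> real N" by (simp only: of_nat_le_iff)
      then have "2 ^ k' \<le> real N" by simp
      also have "\<dots> \<le> \<Lambda> * (6 * (L + 2 * \<delta> + real k * \<delta>) + 2)"
      proof -
        have "6 * M + 2 \<le> 6 * (L + 2 * \<delta> + real k * \<delta>) + 2"
          by (intro add_right_mono mult_left_mono Mk) simp
        then show ?thesis using N mult_left_mono[OF _ \<open>0 \<le> \<Lambda>\<close>] order_trans by blast
      qed
      also have "\<dots> \<le> A + B * real k'"
        using assms delta_nonneg by (simp add: A_def B_def Suc algebra_simps)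
      finally show ?thesis using k0[of k'] Suc by simp
    qed simp
    then have "real k * \<delta> \<le> real (Suc k\<^sub>0) * \<delta>" using delta_nonneg by (intro mult_right_mono) auto
    moreover obtain i where "i \<le> n" "d (\<gamma> r) (c i) = f r" using f_att by blast
    ultimately show "\<exists>i\<le>n. d (\<gamma> r) (c i) \<le> L + 2 * \<delta> + real (Suc k\<^sub>0) * \<delta>"
      using f_M[OF \<open>r \<le> m\<close>] Mk by (intro exI[of _ i]) auto
  qed
qed

text \<open>The point of the geodesic that is as far from its start as the projection of \<open>y\<close>, rounded down
  to an integer because geodesics are parametrized by integers.\<close>

lemma near_geodesic:
  assumes geo: "\<And>i j. i \<le> j \<Longrightarrow> j \<le> m \<Longrightarrow> d (\<gamma> i) (\<gamma> j) = real (j - i)"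
    and y: "gp y (\<gamma> 0) (\<gamma> m) \<le> C"
  obtains r where "r \<le> m" "d y (\<gamma> r) \<le> C + 1 + 2 * \<delta>"
proof -
  define \<rho> where "\<rho> = gp (\<gamma> 0) y (\<gamma> m)"
  define r where "r = nat \<lfloor>\<rho>\<rfloor>"
  have "0 \<le> \<rho>" unfolding \<rho>_def by (rule gp_nonneg)
  have "\<rho> \<le> real m"
    using gp_le_dist[of "\<gamma> 0" "\<gamma> m" y] gp_commute[of "\<gamma> 0"] geo[of 0 m] by (simp add: \<rho>_def)
  have r: "real r \<le> \<rho>" "\<rho> \<le> real r + 1" using \<open>0 \<le> \<rho>\<close> unfolding r_def by linarith+
  then have "r \<le> m" using \<open>\<rho> \<le> real m\<close> by linarith
  have "gp (\<gamma> 0) (\<gamma> m) (\<gamma> r) = real r"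
    using geo[of 0 m] geo[of 0 r] geo[of r m] dist_sym[of "\<gamma> r" "\<gamma> m"] \<open>r \<le> m\<close> by (simp add: gp_def)
  then have "real r - \<delta> \<le> gp (\<gamma> 0) y (\<gamma> r)"
    using four_point[of "\<gamma> 0" y "\<gamma> m" "\<gamma> r"] r by (simp add: \<rho>_def)
  moreover have "d (\<gamma> 0) y = \<rho> + gp y (\<gamma> 0) (\<gamma> m)" using gp_add[of "\<gamma> 0" y] by (simp add: \<rho>_def)
  ultimately have "d y (\<gamma> r) \<le> C + 1 + 2 * \<delta>"
    using y r geo[of 0 r] \<open>r \<le> m\<close> by (simp add: gp_def[of "\<gamma> 0" y "\<gamma> r"])
  then show thesis using that \<open>r \<le> m\<close> by blast
qed

end


section \<open>Word metrics\<close>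

context group begin

lemma inv_cancel_left [simp]:
  assumes "x \<in> carrier G" "y \<in> carrier G"
  shows "inv x \<otimes> (x \<otimes> y) = y" "x \<otimes> (inv x \<otimes> y) = y"
  using assms by (simp_all flip: m_assoc)

lemmas group_word_simps = m_assoc inv_mult_group

lemma int_pow_conj:
  assumes "g \<in> carrier G" "x \<in> carrier G"
  shows "(g \<otimes> x \<otimes> inv g) [^] (i::int) = g \<otimes> x [^] i \<otimes> inv g"
proof -
  have "(\<lambda>x. g \<otimes> x \<otimes> inv g) \<in> hom G G"
    using assms by (auto intro!: homI simp: group_word_simps)
  then interpret group_hom G G "\<lambda>x. g \<otimes> x \<otimes> inv g" by unfold_locales
  show ?thesis using hom_int_pow[OF assms(2)] by simp
qed

lemma intertwine_int_pow:
  assumes "e \<in> carrier G" "x \<in> carrier G" "y \<in> carrier G" "e \<otimes> x = y \<otimes> e"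
  shows "e \<otimes> x [^] (i::int) = y [^] i \<otimes> e"
proof -
  note [simp] = assms(1-3)
  have "e \<otimes> x \<otimes> inv e = y" using assms(4) by (simp add: m_assoc)
  then have "y [^] i = e \<otimes> x [^] i \<otimes> inv e" using int_pow_conj[of e x i] by simp
  then show ?thesis by (simp add: m_assoc)
qed

lemma infinite_order_int_pow_eq:
  assumes "a \<in> carrier G" "infinite_order G a" "a [^] (i::int) = a [^] (j::int)"
  shows "i = j"
proof -
  have *: "i \<le> j" if "a [^] (i::int) = a [^] (j::int)" for i j
  proof (rule ccontr)
    assume "\<not> i \<le> j"
    then have "a [^] (i - j) = a [^] nat (i - j)" by (subst int_pow_int[symmetric]) simp
    moreover have "a [^] (i - j) = \<one>" using that assms(1) by (simp add: int_pow_diff)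
    ultimately have "a [^] nat (i - j) = \<one>" by simp
    moreover have "nat (i - j) > 0" using \<open>\<not> i \<le> j\<close> by simp
    ultimately show False using assms(2) unfolding infinite_order_def by blast
  qed
  show ?thesis using *[of i j] *[of j i] assms(3) by simp
qed

lemma infinite_order_int_pow:
  assumes "a \<in> carrier G" "infinite_order G a" "(n::int) \<noteq> 0"
  shows "infinite_order G (a [^] n)"
  unfolding infinite_order_def
proof (intro allI impI notI)
  fix k :: nat assume "0 < k" "(a [^] n) [^] k = \<one>"
  then have "a [^] (n * int k) = a [^] (0::int)"
    using int_pow_pow[OF assms(1), of n "int k"] by (simp add: int_pow_int)
  then have "n * int k = 0" using infinite_order_int_pow_eq assms by blast
  then show False using assms(3) \<open>0 < k\<close> by simp
qed

lemma intertwine_iterate: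
  assumes "e \<in> carrier G" "a \<in> carrier G" "e \<otimes> a [^] (n::int) = a [^] (m::int) \<otimes> e"
  shows "e [^] r \<otimes> a [^] (n ^ r) = a [^] (m ^ r) \<otimes> e [^] (r::nat)"
proof (induction r)
  case 0
  show ?case using assms by simp
next
  case (Suc r)
  note [simp] = assms(1,2)
  have "e [^] Suc r \<otimes> a [^] (n ^ Suc r) = e [^] r \<otimes> (e \<otimes> (a [^] n) [^] (n ^ r))"
    by (simp add: m_assoc int_pow_pow)
  also have "\<dots> = e [^] r \<otimes> ((a [^] m) [^] (n ^ r) \<otimes> e)"
    by (subst intertwine_int_pow[OF _ _ _ assms(3)]) auto
  also have "\<dots> = (e [^] r \<otimes> (a [^] (n ^ r)) [^] m) \<otimes> e"
    by (simp add: m_assoc int_pow_pow mult.commute)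
  also have "\<dots> = ((a [^] (m ^ r)) [^] m \<otimes> e [^] r) \<otimes> e"
    by (subst intertwine_int_pow[OF _ _ _ Suc]) auto
  also have "\<dots> = a [^] (m ^ Suc r) \<otimes> e [^] Suc r"
    by (simp add: m_assoc int_pow_pow mult.commute)
  finally show ?case .
qed

lemma intertwine_nonzero:
  assumes "a \<in> carrier G" "infinite_order G a" "e \<in> carrier G"
    and "e \<otimes> a [^] (n::int) = a [^] (m::int) \<otimes> e" "m \<noteq> 0"
  shows "n \<noteq> 0"
proof
  assume "n = 0"
  then have "a [^] m \<otimes> e = \<one> \<otimes> e" using assms by simp
  then have "a [^] m = a [^] (0::int)" using assms(1,3) by (subst (asm) right_cancel) auto
  then show False using infinite_order_int_pow_eq[OF assms(1,2)] assms(5) by blast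
qed

definition wlen :: "'a set \<Rightarrow> 'a \<Rightarrow> nat" where
  "wlen X x = word_dist G X \<one> x"

lemma word_value_simps [simp]:
  "word_value G [] = \<one>" "word_value G (x # w) = x \<otimes> word_value G w"
  by (simp_all add: word_value_def)

lemma word_value_closed [simp, intro]:
  "set w \<subseteq> carrier G \<Longrightarrow> word_value G w \<in> carrier G"
  by (induction w) auto

lemma word_value_append:
  "set v \<subseteq> carrier G \<Longrightarrow> set w \<subseteq> carrier G \<Longrightarrow> word_value G (v @ w) = word_value G v \<otimes> word_value G w"
  by (induction v) (auto simp: m_assoc)

lemma word_value_inv:
  "set w \<subseteq> carrier G \<Longrightarrow> word_value G (map (m_inv G) (rev w)) = inv (word_value G w)"
proof (induction w)
  case (Cons x w)
  then have "set (map (m_inv G) (rev w)) \<subseteq> carrier G" by auto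
  then show ?case using Cons by (subst rev.simps) (auto simp: word_value_append inv_mult_group)
qed simp

end

locale marked_group = group G for G (structure) +
  fixes X :: "'a set"
  assumes gens: "finite_generating_set G X"
begin

abbreviation letters :: "'a set" where
  "letters \<equiv> X \<union> m_inv G ` X"

lemma finite_X: "finite X" and X_carrier: "X \<subseteq> carrier G" and generate_X: "generate G X = carrier G"
  using gens by (auto simp: finite_generating_set_def)

lemma letters_carrier: "letters \<subseteq> carrier G"
  using X_carrier by auto

lemma letters_inv: "x \<in> letters \<Longrightarrow> inv x \<in> letters"
  using X_carrier by (auto simp: subset_iff)

lemma word_exists:
  assumes "x \<in> carrier G"
  shows "\<exists>w. set w \<subseteq> letters \<and> word_value G w = x"
proof -
  have "x \<in> generate G X" using assms by (simp add: generate_X)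
  then show ?thesis
  proof (induction x rule: generate.induct)
    case one
    show ?case by (intro exI[of _ "[]"]) simp
  next
    case (incl h)
    then show ?case using X_carrier by (intro exI[of _ "[h]"]) auto
  next
    case (inv h)
    then show ?case using X_carrier by (intro exI[of _ "[inv h]"]) auto
  next
    case (eng x y)
    then obtain v w where "set v \<subseteq> letters" "word_value G v = x" "set w \<subseteq> letters" "word_value G w = y"
      by blast
    moreover from this have "set v \<subseteq> carrier G" "set w \<subseteq> carrier G" using letters_carrier by blast+
    ultimately show ?case by (intro exI[of _ "v @ w"]) (simp add: word_value_append)
  qed
qed

lemma shortest_word:
  assumes "x \<in> carrier G"
  obtains w where "length w = wlen X x" "set w \<subseteq> letters" "word_value G w = x"
proof -
  have eq: "inv \<one> \<otimes> x = x" using assms by simp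
  have "\<exists>n w. length w = n \<and> set w \<subseteq> letters \<and> word_value G w = x"
    using word_exists[OF assms] by blast
  from LeastI_ex[OF this] show thesis using that unfolding wlen_def word_dist_def eq by blast
qed

lemma wlen_le:
  assumes "set w \<subseteq> letters"
  shows "wlen X (word_value G w) \<le> length w"
proof -
  have "set w \<subseteq> carrier G" using assms letters_carrier by blast
  then have eq: "inv \<one> \<otimes> word_value G w = word_value G w" by auto
  show ?thesis unfolding wlen_def word_dist_def eq using assms by (intro Least_le) auto
qed

lemma word_dist_eq_wlen:
  "g \<in> carrier G \<Longrightarrow> h \<in> carrier G \<Longrightarrow> word_dist G X g h = wlen X (inv g \<otimes> h)"
  by (simp add: word_dist_def wlen_def)

lemma wlen_one [simp]: "wlen X \<one> = 0"
  using wlen_le[of "[]"] by simp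

lemma wlen_mult:
  assumes "x \<in> carrier G" "y \<in> carrier G"
  shows "wlen X (x \<otimes> y) \<le> wlen X x + wlen X y"
proof -
  obtain v where v: "length v = wlen X x" "set v \<subseteq> letters" "word_value G v = x"
    using shortest_word[OF assms(1)] .
  obtain w where w: "length w = wlen X y" "set w \<subseteq> letters" "word_value G w = y"
    using shortest_word[OF assms(2)] .
  have "set v \<subseteq> carrier G" "set w \<subseteq> carrier G" using v w letters_carrier by blast+
  then show ?thesis using wlen_le[of "v @ w"] v w by (simp add: word_value_append)
qed

lemma wlen_inv [simp]:
  assumes "x \<in> carrier G"
  shows "wlen X (inv x) = wlen X x"
proof -
  have *: "wlen X (inv x) \<le> wlen X x" if x: "x \<in> carrier G" for x
  proof -
    obtain v where v: "length v = wlen X x" "set v \<subseteq> letters" "word_value G v = x"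
      using shortest_word[OF x] .
    then have "set v \<subseteq> carrier G" using letters_carrier by blast
    then have "word_value G (map (m_inv G) (rev v)) = inv x" using word_value_inv v by blast
    moreover have "set (map (m_inv G) (rev v)) \<subseteq> letters" using v letters_inv by auto
    ultimately show ?thesis using wlen_le[of "map (m_inv G) (rev v)"] v by simp
  qed
  show ?thesis using *[OF assms] *[of "inv x"] assms by simp
qed

lemma finite_wlen_ball: "finite {x \<in> carrier G. wlen X x \<le> n}"
proof (rule finite_subset)
  show "{x \<in> carrier G. wlen X x \<le> n} \<subseteq> word_value G ` {w. set w \<subseteq> letters \<and> length w \<le> n}"
    using shortest_word by (smt (verit) image_eqI mem_Collect_eq subsetI)
  show "finite (word_value G ` {w. set w \<subseteq> letters \<and> length w \<le> n})"
    using finite_X by (intro finite_imageI finite_lists_length_le) auto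
qed

text \<open>The values of the prefixes of a shortest word: a shortcut between two of them would shorten
  the whole word.\<close>

lemma geodesic:
  assumes "x \<in> carrier G"
  obtains \<gamma> where "\<gamma> 0 = \<one>" "\<gamma> (wlen X x) = x" "\<And>i. \<gamma> i \<in> carrier G"
    "\<And>i j. i \<le> j \<Longrightarrow> j \<le> wlen X x \<Longrightarrow> wlen X (inv (\<gamma> i) \<otimes> \<gamma> j) = j - i"
proof -
  obtain w where w: "length w = wlen X x" "set w \<subseteq> letters" "word_value G w = x"
    using shortest_word[OF assms] .
  define \<gamma> where "\<gamma> i = word_value G (take i w)" for i
  have wG: "set w \<subseteq> carrier G" using w letters_carrier by blast
  have tk: "set (take i w) \<subseteq> letters" "set (drop i w) \<subseteq> letters"
    "set (take i w) \<subseteq> carrier G" "set (drop i w) \<subseteq> carrier G" for i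
    using w(2) wG set_take_subset[of i w] set_drop_subset[of i w] by blast+
  have cl: "\<gamma> i \<in> carrier G" for i unfolding \<gamma>_def using tk by blast
  have upper: "wlen X (inv (\<gamma> i) \<otimes> \<gamma> j) \<le> j - i" if "i \<le> j" "j \<le> wlen X x" for i j
  proof -
    have t: "set (take (j - i) (drop i w)) \<subseteq> letters"
      using tk(2)[of i] set_take_subset[of "j - i" "drop i w"] by blast
    then have tG: "set (take (j - i) (drop i w)) \<subseteq> carrier G" using letters_carrier by blast
    have "take j w = take i w @ take (j - i) (drop i w)"
      using that by (metis le_add_diff_inverse take_add)
    then have "\<gamma> j = \<gamma> i \<otimes> word_value G (take (j - i) (drop i w))"
      unfolding \<gamma>_def using tk tG by (metis word_value_append)
    then have "inv (\<gamma> i) \<otimes> \<gamma> j = word_value G (take (j - i) (drop i w))"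
      using cl tG by simp
    then show ?thesis using wlen_le[OF t] that w(1) by simp
  qed
  have ends: "\<gamma> 0 = \<one>" "\<gamma> (wlen X x) = x" using w by (simp_all add: \<gamma>_def)
  have "wlen X (inv (\<gamma> i) \<otimes> \<gamma> j) = j - i" if ij: "i \<le> j" "j \<le> wlen X x" for i j
  proof -
    have "x = (inv (\<gamma> 0) \<otimes> \<gamma> i) \<otimes> ((inv (\<gamma> i) \<otimes> \<gamma> j) \<otimes> (inv (\<gamma> j) \<otimes> \<gamma> (wlen X x)))"
      using cl[of i] cl[of j] assms by (simp add: ends m_assoc)
    also have "wlen X \<dots> \<le> wlen X (inv (\<gamma> 0) \<otimes> \<gamma> i) + (wlen X (inv (\<gamma> i) \<otimes> \<gamma> j)
        + wlen X (inv (\<gamma> j) \<otimes> \<gamma> (wlen X x)))"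
      using cl order_trans[OF wlen_mult add_left_mono[OF wlen_mult]] by (metis inv_closed m_closed)
    finally have "wlen X x \<le> i + (wlen X (inv (\<gamma> i) \<otimes> \<gamma> j) + (wlen X x - j))"
      using upper[of 0 i] upper[of j "wlen X x"] ij by simp
    then show ?thesis using upper[OF ij] ij by simp
  qed
  then show thesis using that[of \<gamma>] ends cl by blast
qed

lemma wlen_Lipschitz:
  assumes "marked_group G Y"
  obtains \<Lambda> :: real where "1 \<le> \<Lambda>" "\<And>x. x \<in> carrier G \<Longrightarrow> real (wlen X x) \<le> \<Lambda> * real (wlen Y x)"
proof -
  interpret Y: marked_group G Y by fact
  define M where "M = Max (insert 1 (wlen X ` Y.letters))"
  have M: "wlen X y \<le> M" if "y \<in> Y.letters" for y
    unfolding M_def using that Y.finite_X by (intro Max_ge) auto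
  have "1 \<le> M" unfolding M_def using Y.finite_X by (intro Max_ge) auto
  have "wlen X (word_value G w) \<le> M * length w" if "set w \<subseteq> Y.letters" for w
    using that
  proof (induction w)
    case (Cons y w)
    have "y \<in> carrier G" "word_value G w \<in> carrier G" using Cons.prems Y.letters_carrier by auto
    then have "wlen X (word_value G (y # w)) \<le> wlen X y + wlen X (word_value G w)"
      using wlen_mult by simp
    also have "\<dots> \<le> M + M * length w" using Cons M[of y] by (intro add_mono) auto
    finally show ?case by simp
  qed simp
  then have "wlen X x \<le> M * wlen Y x" if "x \<in> carrier G" for x
    using Y.shortest_word[OF that] by metis
  then have "real (wlen X x) \<le> real M * real (wlen Y x)" if "x \<in> carrier G" for x
    using that by (metis of_nat_le_iff of_nat_mult)
  then show thesis using \<open>1 \<le> M\<close> by (intro that[of "real M"]) auto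
qed

end

section \<open>Cyclic subgroups of hyperbolic groups\<close>

locale gromov_group = marked_group G S for G (structure) and S +
  fixes \<delta> :: real
  assumes hyp: "\<lbrakk>w \<in> carrier G; x \<in> carrier G; y \<in> carrier G; z \<in> carrier G\<rbrakk> \<Longrightarrow>
     gromov_product (\<lambda>g h. real (word_dist G S g h)) w x z \<ge>
     min (gromov_product (\<lambda>g h. real (word_dist G S g h)) w x y)
         (gromov_product (\<lambda>g h. real (word_dist G S g h)) w y z) - \<delta>"
begin

text \<open>Points outside the carrier are treated as the identity. This makes the word metric a
  pseudometric on the whole type, so that the geometry above applies without carrier conditions.\<close>

definition wdist :: "'a \<Rightarrow> 'a \<Rightarrow> real" where
  "wdist x y = (let r = (\<lambda>x. if x \<in> carrier G then x else \<one>) in real (word_dist G S (r x) (r y)))"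

lemma wdist_eq: "x \<in> carrier G \<Longrightarrow> y \<in> carrier G \<Longrightarrow> wdist x y = real (wlen S (inv x \<otimes> y))"
  by (simp add: wdist_def word_dist_eq_wlen)

end

sublocale gromov_group \<subseteq> hyperbolic_space wdist \<delta>
proof
  define r where "r x = (if x \<in> carrier G then x else \<one>)" for x
  have r: "r x \<in> carrier G" for x by (simp add: r_def)
  have d: "wdist x y = real (word_dist G S (r x) (r y))" for x y
    by (simp add: wdist_def Let_def r_def)
  have d': "wdist x y = real (wlen S (inv (r x) \<otimes> r y))" for x y
    using r by (simp add: d word_dist_eq_wlen)
  fix w x y z
  show "wdist x x = 0" using r by (simp add: d')
  have "inv (inv (r x) \<otimes> r y) = inv (r y) \<otimes> r x" using r by (simp add: inv_mult_group)
  then show "wdist x y = wdist y x"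
    using wlen_inv[of "inv (r x) \<otimes> r y"] r by (simp add: d')
  have "(inv (r x) \<otimes> r y) \<otimes> (inv (r y) \<otimes> r z) = inv (r x) \<otimes> r z" using r by (simp add: m_assoc)
  then show "wdist x z \<le> wdist x y + wdist y z"
    using wlen_mult[of "inv (r x) \<otimes> r y" "inv (r y) \<otimes> r z"] r by (simp add: d' flip: of_nat_add)
  show "min (gromov_product wdist w x y) (gromov_product wdist w y z) - \<delta> \<le> gromov_product wdist w x z"
    using hyp[OF r r r r, of w x y z] by (simp add: gromov_product_def d)
qed

context gromov_group begin

lemma dist_left_mult [simp]:
  assumes "g \<in> carrier G" "x \<in> carrier G" "y \<in> carrier G"
  shows "wdist (g \<otimes> x) (g \<otimes> y) = wdist x y"
  using assms by (simp add: wdist_eq group_word_simps)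

lemma gp_left_mult [simp]:
  assumes "g \<in> carrier G" "w \<in> carrier G" "x \<in> carrier G" "y \<in> carrier G"
  shows "gp (g \<otimes> w) (g \<otimes> x) (g \<otimes> y) = gp w x y"
  using assms by (simp add: gp_def)

lemma dist_one: "x \<in> carrier G \<Longrightarrow> wdist \<one> x = real (wlen S x)"
  by (simp add: wdist_eq)

lemma finite_ball: "finite {x \<in> carrier G. wdist \<one> x \<le> R}"
proof (rule finite_subset[OF _ finite_wlen_ball])
  show "{x \<in> carrier G. wdist \<one> x \<le> R} \<subseteq> {x \<in> carrier G. wlen S x \<le> nat \<lceil>R\<rceil>}"
    by (auto simp: dist_one le_nat_iff) linarith
qed

lemma geodesic_dist:
  assumes "x \<in> carrier G"
  obtains \<gamma> m where "\<gamma> 0 = \<one>" "\<gamma> m = x" "\<And>i. \<gamma> i \<in> carrier G" "wdist \<one> x = real m"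
    "\<And>i j. i \<le> j \<Longrightarrow> j \<le> m \<Longrightarrow> wdist (\<gamma> i) (\<gamma> j) = real (j - i)"
  using geodesic[OF assms] assms by (metis wdist_eq dist_one)

lemma infinite_order_unbounded:
  assumes a: "a \<in> carrier G" "infinite_order G a"
  obtains n :: nat where "n \<ge> n\<^sub>0" "wdist \<one> (a [^] int n) > R"
proof -
  have "\<not> (\<lambda>n::nat. a [^] int n) ` {n\<^sub>0..} \<subseteq> {x \<in> carrier G. wdist \<one> x \<le> R}"
  proof
    assume "(\<lambda>n::nat. a [^] int n) ` {n\<^sub>0..} \<subseteq> {x \<in> carrier G. wdist \<one> x \<le> R}"
    then have "finite ((\<lambda>n::nat. a [^] int n) ` {n\<^sub>0..})" using finite_ball finite_subset by blast
    moreover have "inj_on (\<lambda>n::nat. a [^] int n) {n\<^sub>0..}"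
      using infinite_order_int_pow_eq[OF a] by (metis (mono_tags, lifting) inj_onI of_nat_eq_iff)
    ultimately show False using finite_imageD infinite_Ici by blast
  qed
  then show thesis using a that by force
qed

lemma dist_pow_le:
  assumes "a \<in> carrier G"
  shows "wdist (a [^] (i::int)) (a [^] (j::int)) \<le> real_of_int \<bar>i - j\<bar> * wdist \<one> a"
proof -
  have *: "wdist \<one> (a [^] int n) \<le> real n * wdist \<one> a" for n
  proof (induction n)
    case (Suc n)
    have "a [^] int (Suc n) = a [^] int n \<otimes> a" using assms int_pow_mult[of a "int n" 1] by (simp add: add.commute)
    then have "wdist (a [^] int n) (a [^] int (Suc n)) = wdist \<one> a"
      using dist_left_mult[of "a [^] int n" \<one> a] assms by simp
    then show ?case
      using Suc dist_tri[of \<one> "a [^] int (Suc n)" "a [^] int n"] by (simp add: algebra_simps)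
  qed (simp add: dist_self)
  have **: "wdist (a [^] (i::int)) (a [^] (j::int)) \<le> real_of_int \<bar>i - j\<bar> * wdist \<one> a" if "i \<le> j" for i j
  proof -
    have "a [^] j = a [^] i \<otimes> a [^] int (nat (j - i))"
      using assms that by (simp flip: int_pow_mult)
    then have "wdist (a [^] i) (a [^] j) = wdist \<one> (a [^] int (nat (j - i)))"
      using dist_left_mult[of "a [^] i" \<one> "a [^] int (nat (j - i))"] assms by simp
    then show ?thesis using *[of "nat (j - i)"] that by simp
  qed
  show ?thesis using **[of i j] **[of j i] dist_sym[of "a [^] i" "a [^] j"] by (cases "i \<le> j") auto
qed

text \<open>Let \<open>p\<close> be the midpoint of a geodesic from \<open>1\<close> to a long power \<open>a\<^sup>n\<close>. For small exponents \<open>k\<close> the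
  translate of this geodesic by \<open>a\<^sup>k\<close> has almost the same endpoints, so near \<open>p\<close> it follows the original,
  shifted by some amount \<open>\<beta>\<close>; the shift of \<open>a\<^sup>-\<^sup>k\<close> is then about \<open>- \<beta>\<close>. Since the points \<open>a\<^sup>k p\<close> are
  distinct and balls are finite, one of the first few \<open>k\<close> moves \<open>p\<close> by a large amount. For this \<open>k\<close>, the
  points \<open>a\<^sup>-\<^sup>k p\<close>, \<open>p\<close>, \<open>a\<^sup>k p\<close> lie far apart and, up to multiples of \<open>\<delta>\<close>, on a geodesic with \<open>p\<close> in the middle, and
  \<open>chain_quasi_line\<close> applies to the orbit of \<open>p\<close> under \<open>a\<^sup>k\<close>, which is at bounded distance from the
  powers of \<open>a\<close>.\<close>

lemma infinite_order_quasi_line: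
  assumes a: "a \<in> carrier G" "infinite_order G a"
  obtains C where "quasi_line (\<lambda>i. a [^] (i::int)) C"
proof -
  (* The turn at p will be at most 7 \<delta>, and R exceeds 2 (7 \<delta>) + 3 \<delta>, the length of steps that
     chain_quasi_line asks for. *)
  define R where "R = 17 * \<delta> + 1"
  define B where "B = card {x \<in> carrier G. wdist \<one> x \<le> R}"
  define \<kappa> where "\<kappa> = real B * wdist \<one> a"
  define T where "T = 2 * \<kappa> + 6 * \<delta> + 1"
  have [simp]: "a \<in> carrier G" by fact
  have \<kappa>0: "0 \<le> \<kappa>" by (simp add: \<kappa>_def dist_nonneg)
  have \<kappa>: "wdist (a [^] i) (a [^] j) \<le> \<kappa>" if "\<bar>i - j\<bar> \<le> int B" for i j :: int
  proof -
    have "real_of_int \<bar>i - j\<bar> * wdist \<one> a \<le> real B * wdist \<one> a"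
      using that by (intro mult_right_mono dist_nonneg) linarith
    then show ?thesis using dist_pow_le[OF a(1), of i j] by (simp add: \<kappa>_def)
  qed
  obtain n where n: "wdist \<one> (a [^] int n) > 2 * T + 2" using infinite_order_unbounded[OF a] by metis
  define F where "F = a [^] int n"
  have [simp]: "F \<in> carrier G" by (simp add: F_def)
  obtain \<gamma> m where \<gamma>: "\<gamma> 0 = \<one>" "\<gamma> m = F" "\<And>i. \<gamma> i \<in> carrier G" "wdist \<one> F = real m"
    "\<And>i j. i \<le> j \<Longrightarrow> j \<le> m \<Longrightarrow> wdist (\<gamma> i) (\<gamma> j) = real (j - i)"
    using geodesic_dist[of F] by auto
  define p where "p = \<gamma> (m div 2)"
  have [simp]: "p \<in> carrier G" using \<gamma>(3) by (simp add: p_def)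
  have m: "real m > 2 * T + 2" using n \<gamma>(4) by (simp add: F_def)
  have p1: "wdist \<one> p = real (m div 2)" and pF: "wdist p F = real (m - m div 2)"
    using \<gamma>(5)[of 0 "m div 2"] \<gamma>(5)[of "m div 2" m] by (simp_all add: p_def \<gamma>)
  have "real m \<le> 2 * real (m div 2) + 1" "real (m - m div 2) \<ge> real (m div 2)" by linarith+
  then have T: "T < wdist \<one> p" "T < wdist p F" using m p1 pF by linarith+
  have "gp p \<one> F = 0" using p1 pF \<gamma>(4) dist_sym[of p \<one>] by (simp add: gp_def)
  have "\<exists>k\<le>B. wdist p (a [^] int k \<otimes> p) > R"
  proof (rule ccontr)
    assume "\<not> ?thesis"
    then have "wdist p (a [^] int k \<otimes> p) \<le> R" if "k \<le> B" for k using that by force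
    then have "(\<lambda>k. inv p \<otimes> (a [^] int k \<otimes> p)) ` {..B} \<subseteq> {x \<in> carrier G. wdist \<one> x \<le> R}"
      by (auto simp: wdist_eq)
    moreover have "inj_on (\<lambda>k. inv p \<otimes> (a [^] int k \<otimes> p)) {..B}"
    proof (rule inj_onI)
      fix i j assume "inv p \<otimes> (a [^] int i \<otimes> p) = inv p \<otimes> (a [^] int j \<otimes> p)"
      then have "a [^] int i = a [^] int j" by simp
      then show "i = j" using infinite_order_int_pow_eq[OF a] by fastforce
    qed
    ultimately have "card {..B} \<le> B" unfolding B_def using card_inj_on_le finite_ball by blast
    then show False by simp
  qed
  then obtain k where k: "k \<le> B" "wdist p (a [^] int k \<otimes> p) > R" by blast
  have "k \<noteq> 0" using k(2) delta_nonneg by (intro notI) (simp add: dist_self R_def)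
  define P M E where "P = a [^] int k \<otimes> p" and "M = a [^] (- int k) \<otimes> p" and "E = a [^] int k"
  have [simp]: "P \<in> carrier G" "M \<in> carrier G" "E \<in> carrier G" by (simp_all add: P_def M_def E_def)
  have "gp (a [^] int k \<otimes> p) (a [^] int k \<otimes> \<one>) (a [^] int k \<otimes> F) = 0"
    by (subst gp_left_mult) (auto simp: \<open>gp p \<one> F = 0\<close>)
  then have "gp P E (E \<otimes> F) \<le> 0" by (simp add: P_def E_def)
  moreover have PE: "wdist P E = wdist \<one> p"
    using dist_left_mult[of "a [^] int k" p \<one>] dist_sym[of p] by (simp add: P_def E_def)
  moreover have "wdist P (E \<otimes> F) = wdist p F" by (simp add: P_def E_def)
  moreover have E1: "wdist E \<one> \<le> \<kappa>" using \<kappa>[of "int k" 0] k by (simp add: E_def)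
  moreover have "wdist (E \<otimes> F) F \<le> \<kappa>"
    using \<kappa>[of "int k + int n" "int n"] k by (simp add: E_def F_def int_pow_mult)
  ultimately have gpP: "gp P \<one> F \<le> 2 * \<delta>"
    using gp_far_endpoints[of P E "E \<otimes> F" 0 \<one> F] T \<kappa>0 delta_nonneg by (simp add: T_def)
  define \<beta> where "\<beta> = wdist P \<one> - wdist p \<one>"
  have \<beta>: "\<bar>\<beta>\<bar> \<le> \<kappa>"
    using PE E1 dist_tri[of P \<one> E] dist_tri[of P E \<one>] dist_sym[of E \<one>] dist_sym[of p \<one>] by (simp add: \<beta>_def)
  have "wdist p P + wdist \<one> F \<le> max (wdist p \<one> + wdist P F) (wdist p F + wdist \<one> P) + 2 * \<delta>"
    by (rule four_point_sums)
  moreover have "wdist P F \<le> wdist \<one> F - wdist P \<one> + 4 * \<delta>" using gpP by (simp add: gp_def)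
  moreover have "wdist p F = wdist \<one> F - wdist p \<one>" using \<open>gp p \<one> F = 0\<close> by (simp add: gp_def)
  ultimately have pP: "wdist p P \<le> \<bar>\<beta>\<bar> + 6 * \<delta>"
    using dist_sym[of P \<one>] dist_sym[of p \<one>] delta_nonneg unfolding \<beta>_def by linarith
  (* The shift of M is wdist p E - wdist p \<one>. It is the negative of \<beta> up to 2 \<delta>: the two sums of
     distances between {P, p} and {\<one>, E} nearly agree, because \<one> and E, and likewise p and P, are much closer to each other
     than the two pairs are. *)
  have M1: "wdist M \<one> = wdist p E"
    using dist_left_mult[of "a [^] int k" M \<one>] by (simp add: M_def E_def int_pow_neg)
  have "wdist P \<one> + wdist p E \<le> max (wdist P E + wdist \<one> p) (wdist P p + wdist E \<one>) + 2 * \<delta>"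
    using four_point_sums[of P \<one> E p] by (simp add: dist_sym)
  moreover have "wdist P E + wdist p \<one> \<le> max (wdist P \<one> + wdist p E) (wdist P p + wdist \<one> E) + 2 * \<delta>"
    using four_point_sums[of P E \<one> p] by (simp add: dist_sym)
  moreover have "wdist P p + wdist E \<one> \<le> 2 * \<kappa> + 6 * \<delta>"
    using pP \<beta> E1 dist_sym[of p P] by linarith
  moreover have "wdist p \<one> - \<kappa> \<le> wdist p E" using E1 dist_tri[of p \<one> E] by linarith
  ultimately have "\<bar>wdist P \<one> + wdist p E - 2 * wdist p \<one>\<bar> \<le> 2 * \<delta>"
    using T \<beta> PE dist_sym[of p \<one>] dist_sym[of E \<one>] \<kappa>0 delta_nonneg
    unfolding \<beta>_def T_def by (simp add: max_def abs_if split: if_splits)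
  then have "2 * \<bar>\<beta>\<bar> - 2 * \<delta> \<le> wdist M P"
    using dist_tri[of M \<one> P] dist_tri[of P \<one> M] dist_sym[of P M] M1 unfolding \<beta>_def
    by (simp add: abs_if split: if_splits)
  moreover have "wdist p M = wdist p P"
    using dist_left_mult[of "a [^] int k" p M] dist_sym[of p P] by (simp add: M_def P_def int_pow_neg)
  ultimately have turn: "gp p M P \<le> 7 * \<delta>" using pP by (simp add: gp_def)
  define x where "x i = a [^] (int k * i) \<otimes> p" for i
  have xs: "x (i + j) = a [^] (int k * i) \<otimes> (a [^] (int k * j) \<otimes> p)" for i j
    by (simp add: x_def distrib_left m_assoc int_pow_mult)
  have "gp (x i) (x (i - 1)) (x (i + 1)) = gp p M P" for i
    using xs[of i 0] xs[of i "-1"] xs[of i 1] by (simp add: M_def P_def)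
  moreover have "wdist (x i) (x (i + 1)) = wdist p P" for i
    using xs[of i 0] xs[of i 1] by (simp add: P_def)
  ultimately have "quasi_line x (7 * \<delta> + 2 * \<delta>)"
    using turn k(2) by (intro chain_quasi_line) (auto simp: P_def R_def)
  moreover have "mono (\<lambda>i::int. i div int k)" using \<open>k \<noteq> 0\<close> by (intro monoI zdiv_mono1) auto
  moreover have "wdist (x (i div int k)) (a [^] i) \<le> wdist p \<one> + \<kappa>" for i
  proof -
    have "\<bar>int k * (i div int k) - i\<bar> \<le> int B"
    proof -
      have "int k * (i div int k) - i = - (i mod int k)" by (simp add: minus_mod_eq_mult_div[symmetric])
      then show ?thesis
        using k(1) \<open>k \<noteq> 0\<close> pos_mod_bound[of "int k" i] pos_mod_sign[of "int k" i] by linarith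
    qed
    then have "wdist (a [^] (int k * (i div int k))) (a [^] i) \<le> \<kappa>" by (rule \<kappa>)
    moreover have "wdist (x (i div int k)) (a [^] (int k * (i div int k))) = wdist p \<one>"
      using dist_left_mult[of "a [^] (int k * (i div int k))" p \<one>] by (simp add: x_def)
    ultimately show ?thesis
      using dist_tri[of "x (i div int k)" "a [^] i" "a [^] (int k * (i div int k))"] by linarith
  qed
  ultimately show thesis using quasi_line_close that by blast
qed

lemma near_power:
  assumes "a \<in> carrier G" "quasi_line (\<lambda>i. a [^] (i::int)) C"
    and y: "gp y (a [^] (s::int)) (a [^] (t::int)) \<le> C'"
  obtains l :: int where "wdist y (a [^] l) \<le> 2 * C' + C + 2 * \<delta> + wdist \<one> a"
proof -
  have C0: "0 \<le> C" by (rule quasi_line_nonneg[OF assms(2)])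
  have C'0: "0 \<le> C'" using order_trans[OF gp_nonneg y] .
  have *: "\<exists>l::int. wdist y (a [^] l) \<le> 2 * C' + C + 2 * \<delta> + wdist \<one> a"
    if st: "s < t" "gp y (a [^] s) (a [^] t) \<le> C'" for s t :: int
  proof -
    obtain j :: int where j: "gp y (a [^] j) (a [^] (j + 1)) \<le> 2 * C' + C + 2 * \<delta>"
      using quasi_line_passes[OF assms(2) st] by blast
    moreover have "wdist (a [^] j) (a [^] (j + 1)) \<le> wdist \<one> a"
      using dist_pow_le[OF assms(1), of j "j + 1"] by simp
    ultimately show ?thesis using gp_ge[of y "a [^] j" "a [^] (j + 1)"] by (intro exI[of _ j]) linarith
  qed
  consider "s < t" | "t < s" | "s = t" by linarith
  then show thesis
  proof cases
    case 1 then show ?thesis using *[of s t] y that by blast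
  next
    case 2 then show ?thesis using *[of t s] y that gp_commute[of y "a [^] s" "a [^] t"] by auto
  next
    case 3
    then have "wdist y (a [^] s) \<le> C'" using y by (simp add: gp_def dist_self)
    then show ?thesis using C0 C'0 delta_nonneg dist_nonneg[of \<one> a] by (intro that[of s]) linarith
  qed
qed

text \<open>If \<open>f\<close> conjugates powers of \<open>a\<close> to powers of \<open>a\<close>, the line \<open>f \<langle>a\<rangle>\<close> is at bounded distance from \<open>\<langle>a\<rangle>\<close>,
  hence has the same endpoints at infinity. The point of the lemma is that the resulting bound on
  the distance of \<open>f\<close> from \<open>\<langle>a\<rangle>\<close> does not depend on \<open>f\<close>.\<close>

lemma commensurating_near_power:
  assumes a: "a \<in> carrier G" "infinite_order G a" and ql: "quasi_line (\<lambda>i. a [^] (i::int)) C"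
    and f: "f \<in> carrier G" and conj: "f \<otimes> a [^] (n::int) = a [^] (m::int) \<otimes> f" and "m \<noteq> 0"
  obtains l :: int where "wdist f (a [^] l) \<le> 3 * C + 6 * \<delta> + wdist \<one> a"
proof -
  have [simp]: "a \<in> carrier G" "f \<in> carrier G" by fact+
  have "n \<noteq> 0" by (rule intertwine_nonzero[OF a f conj \<open>m \<noteq> 0\<close>])
  then obtain s where s: "wdist \<one> ((a [^] n) [^] int s) > C + 2 * \<delta> + wdist f \<one>"
    using infinite_order_unbounded[OF int_pow_closed[OF a(1)] infinite_order_int_pow[OF a \<open>n \<noteq> 0\<close>],
        of 0 "C + 2 * \<delta> + wdist f \<one>"] by auto
  have c: "f \<otimes> a [^] (n * i) = a [^] (m * i) \<otimes> f" for i
    using intertwine_int_pow[OF f _ _ conj, of i] by (simp add: int_pow_pow)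
  have cl: "wdist (f \<otimes> a [^] (n * i)) (a [^] (m * i)) = wdist f \<one>" for i
    using dist_left_mult[of "a [^] (m * i)" f \<one>] by (simp add: c)
  have far: "wdist f (f \<otimes> a [^] (n * i)) > C + 2 * \<delta> + wdist f \<one>" if "i = int s \<or> i = - int s" for i
  proof -
    have "wdist f (f \<otimes> a [^] (n * i)) = wdist \<one> (a [^] (n * i))"
      using dist_left_mult[of f \<one> "a [^] (n * i)"] by simp
    also have "\<dots> = wdist \<one> ((a [^] n) [^] int s)"
    proof (cases "i = int s")
      case False
      then have "i = - int s" using that by simp
      then have "a [^] (n * i) = inv ((a [^] n) [^] int s)" by (simp add: int_pow_pow int_pow_neg)
      then show ?thesis by (simp add: wdist_eq)
    qed (simp add: int_pow_pow)
    finally show ?thesis using s by simp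
  qed
  have "gp \<one> (a [^] (n * - int s)) (a [^] (n * int s)) \<le> C"
  proof (cases "0 \<le> n")
    case True
    then show ?thesis using quasi_lineD[OF ql, of "n * - int s" 0 "n * int s"] by simp
  next
    case False
    then show ?thesis using quasi_lineD[OF ql, of "n * int s" 0 "n * - int s"]
      by (simp add: gp_commute[of \<one>] mult_le_0_iff)
  qed
  then have "gp f (f \<otimes> a [^] (n * - int s)) (f \<otimes> a [^] (n * int s)) \<le> C"
    using gp_left_mult[of f \<one> "a [^] (n * - int s)" "a [^] (n * int s)"] by simp
  then have "gp f (a [^] (m * - int s)) (a [^] (m * int s)) \<le> C + 2 * \<delta>"
    using far[of "int s"] far[of "- int s"] cl[of "int s"] cl[of "- int s"]
    by (intro gp_far_endpoints) auto
  then obtain l :: int where "wdist f (a [^] l) \<le> 2 * (C + 2 * \<delta>) + C + 2 * \<delta> + wdist \<one> a"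
    using near_power[OF a(1) ql] by blast
  then show thesis by (intro that[of l]) simp
qed

end

section \<open>Shortest representatives of cosets\<close>

definition (in group) shortest_mod :: "'a set \<Rightarrow> 'a set \<Rightarrow> 'a \<Rightarrow> bool" where
  "shortest_mod X N h \<longleftrightarrow> h \<in> carrier G \<and> (\<forall>x\<in>N. wlen X h \<le> wlen X (h \<otimes> x))"

lemma (in group) normal_left_right:
  assumes "N \<lhd> G" "x \<in> carrier G" "n \<in> N"
  shows "x \<otimes> n \<otimes> inv x \<in> N" "inv x \<otimes> n \<otimes> x \<in> N"
  by (rule normal.inv_op_closed2[OF assms], rule normal.inv_op_closed1[OF assms])

context marked_group begin

lemma shortest_mod_inv:
  assumes "N \<lhd> G" "shortest_mod X N h"
  shows "shortest_mod X N (inv h)"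
proof -
  have h: "h \<in> carrier G" using assms(2) by (simp add: shortest_mod_def)
  have "wlen X (inv h) \<le> wlen X (inv h \<otimes> x)" if x: "x \<in> N" for x
  proof -
    have xG: "x \<in> carrier G" using subgroup.mem_carrier[OF normal_imp_subgroup[OF assms(1)] x] .
    have "inv x \<in> N" using subgroup.m_inv_closed[OF normal_imp_subgroup[OF assms(1)] x] .
    then have "inv h \<otimes> inv x \<otimes> h \<in> N" by (rule normal_left_right[OF assms(1) h])
    then have "wlen X h \<le> wlen X (h \<otimes> (inv h \<otimes> inv x \<otimes> h))" using assms(2) by (simp add: shortest_mod_def)
    also have "h \<otimes> (inv h \<otimes> inv x \<otimes> h) = inv (inv h \<otimes> x)" using h xG by (simp add: group_word_simps)
    finally show ?thesis using h xG by simp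
  qed
  then show ?thesis using h by (simp add: shortest_mod_def)
qed

text \<open>Replacing the piece of the geodesic \<open>c\<close> between \<open>c i\<close> and \<open>c j\<close> by the path that goes from \<open>c i\<close> to \<open>z\<close>,
  jumps to \<open>z'\<close>, and continues to \<open>c j\<close> does not change the coset of the endpoint, and the jump costs
  nothing.\<close>

lemma shortest_mod_shortcut:
  assumes N: "N \<lhd> G" and h: "shortest_mod X N h"
    and c: "c 0 = \<one>" "c (wlen X h) = h" "\<And>i. c i \<in> carrier G"
      "\<And>i j. i \<le> j \<Longrightarrow> j \<le> wlen X h \<Longrightarrow> wlen X (inv (c i) \<otimes> c j) = j - i"
    and z: "z \<in> carrier G" "z' \<in> carrier G" "z \<otimes> inv z' \<in> N"
    and ij: "i \<le> j" "j \<le> wlen X h"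
  shows "j - i \<le> wlen X (inv (c i) \<otimes> z) + wlen X (inv (c j) \<otimes> z')"
proof -
  have [simp]: "h \<in> carrier G" using h by (simp add: shortest_mod_def)
  have [simp]: "c i \<in> carrier G" for i by (rule c)
  note [simp] = z(1,2)
  have "wlen X h \<le> wlen X (h \<otimes> (inv h \<otimes> (z \<otimes> inv z') \<otimes> h))"
    using normal_left_right[OF N _ z(3), of h] h by (simp add: shortest_mod_def)
  also have "h \<otimes> (inv h \<otimes> (z \<otimes> inv z') \<otimes> h) =
      c i \<otimes> ((inv (c i) \<otimes> z) \<otimes> (inv (inv (c j) \<otimes> z') \<otimes> (inv (c j) \<otimes> h)))"
    by (simp add: group_word_simps)
  also have "wlen X \<dots> \<le> wlen X (c i) + (wlen X (inv (c i) \<otimes> z) +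
      (wlen X (inv (inv (c j) \<otimes> z')) + wlen X (inv (c j) \<otimes> h)))"
    using wlen_mult[of "c i" "(inv (c i) \<otimes> z) \<otimes> (inv (inv (c j) \<otimes> z') \<otimes> (inv (c j) \<otimes> h))"]
      wlen_mult[of "inv (c i) \<otimes> z" "inv (inv (c j) \<otimes> z') \<otimes> (inv (c j) \<otimes> h)"]
      wlen_mult[of "inv (inv (c j) \<otimes> z')" "inv (c j) \<otimes> h"] by simp
  also have "wlen X (inv (inv (c j) \<otimes> z')) = wlen X (inv (c j) \<otimes> z')" by (rule wlen_inv) simp
  also have "wlen X (c i) = i" using c(4)[of 0 i] ij by (simp add: c(1))
  also have "wlen X (inv (c j) \<otimes> h) = wlen X h - j" using c(4)[of j "wlen X h"] ij by (simp add: c(2))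
  finally show ?thesis using ij by linarith
qed

end

context gromov_group begin

text \<open>The metric form of \<open>shortest_mod_shortcut\<close>. The points \<open>y\<close> and \<open>y'\<close> are near a geodesic to \<open>h\<close> of the
  hyperbolic metric, hence near the geodesic to \<open>h\<close> of the metric of \<open>X\<close>.\<close>

lemma shortest_mod_near_coset_bounded:
  assumes "marked_group G X" and N: "N \<lhd> G"
  obtains F where "\<And>h y y' z z'. \<lbrakk>shortest_mod X N h; y \<in> carrier G; y' \<in> carrier G;
     gp y \<one> h \<le> C; gp y' \<one> h \<le> C; z \<in> carrier G; z' \<in> carrier G; z \<otimes> inv z' \<in> N;
     wdist y z \<le> C; wdist y' z' \<le> C\<rbrakk> \<Longrightarrow> wdist y y' \<le> F"
proof -
  interpret X: marked_group G X by fact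
  obtain \<Lambda> where \<Lambda>: "1 \<le> \<Lambda>" "\<And>x. x \<in> carrier G \<Longrightarrow> real (wlen X x) \<le> \<Lambda> * real (wlen S x)"
    using X.wlen_Lipschitz[OF marked_group_axioms] by blast
  obtain \<Lambda>' where \<Lambda>': "1 \<le> \<Lambda>'" "\<And>x. x \<in> carrier G \<Longrightarrow> real (wlen S x) \<le> \<Lambda>' * real (wlen X x)"
    using wlen_Lipschitz[OF X.marked_group_axioms] by blast
  have "0 \<le> \<Lambda>'" "0 \<le> \<Lambda>" using \<Lambda> \<Lambda>' by auto
  then obtain D where D: "\<And>(c :: nat \<Rightarrow> 'a) n \<gamma> m r. \<lbrakk>\<gamma> 0 = c 0; \<gamma> m = c n;
      \<And>i j. i \<le> j \<Longrightarrow> j \<le> m \<Longrightarrow> wdist (\<gamma> i) (\<gamma> j) = real (j - i);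
      \<And>i. i < n \<Longrightarrow> wdist (c i) (c (Suc i)) \<le> \<Lambda>';
      \<And>i j. i \<le> j \<Longrightarrow> j \<le> n \<Longrightarrow> real (j - i) \<le> \<Lambda> * wdist (c i) (c j); r \<le> m\<rbrakk>
      \<Longrightarrow> \<exists>i\<le>n. wdist (\<gamma> r) (c i) \<le> D"
    using geodesic_near_path[of \<Lambda>' \<Lambda>] by blast
  define D' where "D' = C + 1 + 2 * \<delta> + D"
  show thesis
  proof (rule that[of "2 * D' + \<Lambda>' * (\<Lambda> * (2 * (D' + C)))"])
    fix h y y' z z'
    assume h: "shortest_mod X N h" and y: "y \<in> carrier G" "y' \<in> carrier G"
      "gp y \<one> h \<le> C" "gp y' \<one> h \<le> C"
      and z: "z \<in> carrier G" "z' \<in> carrier G" "z \<otimes> inv z' \<in> N" "wdist y z \<le> C" "wdist y' z' \<le> C"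
    have hG: "h \<in> carrier G" using h by (simp add: shortest_mod_def)
    obtain c where c: "c 0 = \<one>" "c (wlen X h) = h" "\<And>i. c i \<in> carrier G"
      "\<And>i j. i \<le> j \<Longrightarrow> j \<le> wlen X h \<Longrightarrow> wlen X (inv (c i) \<otimes> c j) = j - i"
      using X.geodesic[OF hG] by blast
    obtain \<gamma> m where \<gamma>: "\<gamma> 0 = \<one>" "\<gamma> m = h" "\<And>i. \<gamma> i \<in> carrier G" "wdist \<one> h = real m"
      "\<And>i j. i \<le> j \<Longrightarrow> j \<le> m \<Longrightarrow> wdist (\<gamma> i) (\<gamma> j) = real (j - i)"
      using geodesic_dist[OF hG] by blast
    have up: "wdist (c i) (c j) \<le> \<Lambda>' * real (j - i)" if "i \<le> j" "j \<le> wlen X h" for i j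
      using \<Lambda>'(2)[of "inv (c i) \<otimes> c j"] c(3,4) that by (simp add: wdist_eq)
    have low: "real (j - i) \<le> \<Lambda> * wdist (c i) (c j)" if "i \<le> j" "j \<le> wlen X h" for i j
      using \<Lambda>(2)[of "inv (c i) \<otimes> c j"] c(3,4) that by (simp add: wdist_eq)
    have near: "\<exists>i\<le>wlen X h. wdist y (c i) \<le> D'" if yh: "gp y \<one> h \<le> C" for y
    proof -
      obtain r where r: "r \<le> m" "wdist y (\<gamma> r) \<le> C + 1 + 2 * \<delta>"
        using near_geodesic[of m \<gamma> y C] \<gamma> yh by metis
      have "wdist (c i) (c (Suc i)) \<le> \<Lambda>'" if "i < wlen X h" for i using up[of i "Suc i"] that by simp
      then obtain i where "i \<le> wlen X h" "wdist (\<gamma> r) (c i) \<le> D"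
        using D[of \<gamma> c m "wlen X h" r] \<gamma> c low r by metis
      then show ?thesis
        using r dist_tri[of y "c i" "\<gamma> r"] by (intro exI[of _ i]) (auto simp: D'_def)
    qed
    obtain i where i: "i \<le> wlen X h" "wdist y (c i) \<le> D'" using near y by blast
    obtain j where j: "j \<le> wlen X h" "wdist y' (c j) \<le> D'" using near y by blast
    have w: "real (wlen X (inv (c i) \<otimes> z)) \<le> \<Lambda> * (D' + C)" if "wdist y (c i) \<le> D'" "wdist y z \<le> C" 
      "y \<in> carrier G" "z \<in> carrier G" for y z i
    proof -
      have "real (wlen X (inv (c i) \<otimes> z)) \<le> \<Lambda> * wdist (c i) z"
        using \<Lambda>(2)[of "inv (c i) \<otimes> z"] c(3) that by (simp add: wdist_eq)
      also have "\<dots> \<le> \<Lambda> * (D' + C)"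
        using that dist_tri[of "c i" z y] dist_sym[of "c i" y] \<open>0 \<le> \<Lambda>\<close> by (intro mult_left_mono) auto
      finally show ?thesis .
    qed
    have ij: "wdist (c i) (c j) \<le> \<Lambda>' * (\<Lambda> * (2 * (D' + C)))"
    proof (cases "i \<le> j")
      case True
      have "real (j - i) \<le> real (wlen X (inv (c i) \<otimes> z)) + real (wlen X (inv (c j) \<otimes> z'))"
        using X.shortest_mod_shortcut[OF N h c z(1-3) True j(1)] by linarith
      also have "\<dots> \<le> \<Lambda> * (2 * (D' + C))" using w[OF i(2) z(4) y(1) z(1)] w[OF j(2) z(5) y(2) z(2)] by (simp add: algebra_simps)
      finally show ?thesis using up[OF True j(1)] mult_left_mono[OF _ \<open>0 \<le> \<Lambda>'\<close>] order_trans by blast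
    next
      case False
      then have ji: "j \<le> i" by simp
      have "inv (z \<otimes> inv z') \<in> N" using subgroup.m_inv_closed[OF normal_imp_subgroup[OF N] z(3)] .
      then have "z' \<otimes> inv z \<in> N" using z(1,2) by (simp add: inv_mult_group)
      then have "real (i - j) \<le> real (wlen X (inv (c j) \<otimes> z')) + real (wlen X (inv (c i) \<otimes> z))"
        using X.shortest_mod_shortcut[OF N h c z(2,1) _ ji i(1)] by linarith
      also have "\<dots> \<le> \<Lambda> * (2 * (D' + C))" using w[OF i(2) z(4) y(1) z(1)] w[OF j(2) z(5) y(2) z(2)] by (simp add: algebra_simps)
      finally show ?thesis
        using up[OF ji i(1)] mult_left_mono[OF _ \<open>0 \<le> \<Lambda>'\<close>] order_trans dist_sym[of "c i"] by metis
    qed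
    show "wdist y y' \<le> 2 * D' + \<Lambda>' * (\<Lambda> * (2 * (D' + C)))"
      using ij i j dist_tri[of y y' "c i"] dist_tri[of "c i" y' "c j"] dist_sym[of "c j" y'] by linarith
  qed
qed

end

section \<open>The line of a product\<close>

text \<open>The orbit of the broken path \<open>1, h, h b\<close> under the powers of \<open>h b\<close>: even indices are the powers, and
  the steps are alternately \<open>h\<close> and \<open>b\<close>.\<close>

definition (in group) zigzag :: "'a \<Rightarrow> 'a \<Rightarrow> int \<Rightarrow> 'a" where
  "zigzag h b i = (h \<otimes> b) [^] (i div 2) \<otimes> (if even i then \<one> else h)"

lemma (in group) zigzag_even_odd:
  assumes "h \<in> carrier G" "b \<in> carrier G"
  shows "zigzag h b (2 * i) = (h \<otimes> b) [^] i"
    and "zigzag h b (2 * i + 1) = (h \<otimes> b) [^] i \<otimes> h"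
  using assms by (simp_all add: zigzag_def)

context gromov_group begin

lemma zigzag_closed [simp, intro]:
  "h \<in> carrier G \<Longrightarrow> b \<in> carrier G \<Longrightarrow> zigzag h b i \<in> carrier G"
  by (simp add: zigzag_def)

lemma wdist_zigzag:
  assumes "h \<in> carrier G" "b \<in> carrier G"
  shows "wdist (zigzag h b i) (zigzag h b (i + 1)) = (if even i then wdist \<one> h else wdist \<one> b)"
proof -
  define u where "u = h \<otimes> b"
  note [simp] = assms
  have [simp]: "u \<in> carrier G" by (simp add: u_def)
  note zz = zigzag_even_odd[OF assms, folded u_def]
  show ?thesis
  proof (cases "even i")
    case True
    then obtain k where k: "i = 2 * k" by blast
    have "wdist (u [^] k \<otimes> \<one>) (u [^] k \<otimes> h) = wdist \<one> h" by (rule dist_left_mult) auto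
    then show ?thesis using True zz[of k] by (simp add: k)
  next
    case False
    then obtain k where k: "i = 2 * k + 1" by (rule oddE)
    have i: "i + 1 = 2 * (k + 1)" by (simp add: k)
    have "u [^] (k + 1) = u [^] k \<otimes> h \<otimes> b" by (simp add: int_pow_mult u_def m_assoc)
    moreover have "wdist (u [^] k \<otimes> h \<otimes> \<one>) (u [^] k \<otimes> h \<otimes> b) = wdist \<one> b"
      by (rule dist_left_mult) auto
    ultimately show ?thesis using False zz(1)[of "k + 1"] zz(2)[of k] unfolding i by (simp add: k)
  qed
qed

lemma zigzag_quasi_line:
  assumes "h \<in> carrier G" "b \<in> carrier G"
    and turns: "gp \<one> (inv h) b \<le> C" "gp \<one> (inv b) h \<le> C"
    and long: "wdist \<one> h > 2 * C + 3 * \<delta>" "wdist \<one> b > 2 * C + 3 * \<delta>"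
  shows "quasi_line (zigzag h b) (C + 2 * \<delta>)"
proof (rule chain_quasi_line)
  define u where "u = h \<otimes> b"
  note [simp] = assms(1,2)
  have [simp]: "u \<in> carrier G" by (simp add: u_def)
  note zz = zigzag_even_odd[OF assms(1,2), folded u_def]
  fix i
  show "gp (zigzag h b i) (zigzag h b (i - 1)) (zigzag h b (i + 1)) \<le> C"
  proof (cases "even i")
    case True
    then obtain k where k: "i = 2 * k" by blast
    have i: "i - 1 = 2 * (k - 1) + 1" by (simp add: k)
    have "u [^] (k - 1) \<otimes> h = u [^] k \<otimes> inv b"
      by (simp add: int_pow_diff u_def group_word_simps)
    moreover have "gp (u [^] k \<otimes> \<one>) (u [^] k \<otimes> inv b) (u [^] k \<otimes> h) = gp \<one> (inv b) h"
      by (rule gp_left_mult) auto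
    ultimately show ?thesis using zz(1)[of k] zz(2)[of "k - 1"] zz(2)[of k] turns(2)
      unfolding i by (simp add: k)
  next
    case False
    then obtain k where k: "i = 2 * k + 1" by (rule oddE)
    have i: "i + 1 = 2 * (k + 1)" by (simp add: k)
    have "u [^] (k + 1) = u [^] k \<otimes> h \<otimes> b" by (simp add: int_pow_mult u_def m_assoc)
    moreover have "gp (u [^] k \<otimes> h \<otimes> \<one>) (u [^] k \<otimes> h \<otimes> inv h) (u [^] k \<otimes> h \<otimes> b) = gp \<one> (inv h) b"
      by (rule gp_left_mult) auto
    moreover have "u [^] k \<otimes> h \<otimes> inv h = u [^] k" by (simp add: m_assoc)
    ultimately show ?thesis using zz(1)[of "k + 1"] zz(1)[of k] zz(2)[of k] turns(1)
      unfolding i by (simp add: k)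
  qed
  show "wdist (zigzag h b i) (zigzag h b (i + 1)) > 2 * C + 3 * \<delta>"
    using long by (simp add: wdist_zigzag)
qed

text \<open>An element \<open>g\<close> that commutes with \<open>h b\<close>, in particular a root of \<open>h b\<close>, moves all powers of \<open>h b\<close> by the
  same distance, however far out they are. So the line and its translate by \<open>g\<close> have the same
  endpoints at infinity, and they are close with a bound that does not depend on \<open>g\<close>.\<close>

lemma commuting_preserves_zigzag:
  assumes G: "h \<in> carrier G" "b \<in> carrier G" "g \<in> carrier G" "w \<in> carrier G"
    and comm: "g \<otimes> (h \<otimes> b) = (h \<otimes> b) \<otimes> g"
    and ql: "quasi_line (zigzag h b) C"
    and long: "wdist \<one> h \<ge> 2 * C + 1" "wdist \<one> b \<ge> 2 * C + 1"
    and w: "gp w (zigzag h b i) (zigzag h b (i + 1)) \<le> C'"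
  obtains j where "gp (g \<otimes> w) (zigzag h b j) (zigzag h b (j + 1)) \<le> 2 * C' + 5 * C + 6 * \<delta>"
proof -
  define u where "u = h \<otimes> b"
  note [simp] = G
  have [simp]: "u \<in> carrier G" by (simp add: u_def)
  define x where "x = zigzag h b"
  have x_even: "x (2 * k) = u [^] k" for k by (simp add: x_def u_def zigzag_even_odd)
  have [simp]: "x k \<in> carrier G" for k by (simp add: x_def)
  have esc: "real n \<le> wdist (x k) (x (k + int n))" for k n
    unfolding x_def using long by (intro quasi_line_escapes[OF ql]) (simp add: wdist_zigzag)
  obtain n' :: nat where n': "real n' > C' + 2 * C + 2 * \<delta> + wdist w \<one> + wdist g \<one>"
    using reals_Archimedean2 by blast
  define n where "n = n' + nat (\<bar>i\<bar> + 1)"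
  have n: "2 * real n > C' + 2 * C + 2 * \<delta> + wdist w \<one> + wdist g \<one>" using n' by (simp add: n_def)
  have ni: "- (2 * int n) \<le> i" "i + 1 \<le> 2 * int n" "0 < n" by (auto simp: n_def)
  have "gp w (x (- (2 * int n))) (x (2 * int n)) \<le> C' + 2 * C"
    using quasi_line_between[OF ql ni(1) _ ni(2) w] by (simp add: x_def)
  then have 1: "gp (g \<otimes> w) (g \<otimes> x (- (2 * int n))) (g \<otimes> x (2 * int n)) \<le> C' + 2 * C" by simp
  have "g \<otimes> u [^] k = u [^] k \<otimes> g" for k :: int
    using comm by (intro intertwine_int_pow) (auto simp: u_def)
  then have moved: "wdist (g \<otimes> x (2 * k)) (x (2 * k)) = wdist g \<one>" for k
    using dist_left_mult[of "u [^] k" g \<one>] by (simp add: x_even)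
  have x0: "x 0 = \<one>" using x_even[of 0] by simp
  have far: "wdist (g \<otimes> w) (g \<otimes> x (2 * k)) \<ge> 2 * real n - wdist w \<one>" if "k = int n \<or> k = - int n" for k
  proof -
    have "wdist \<one> (x (2 * k)) \<ge> 2 * real n"
      using that esc[of "2 * n" 0] esc[of "2 * n" "- (2 * int n)"] dist_sym[of \<one> "x (2 * k)"]
      by (auto simp: x0)
    then show ?thesis using dist_tri[of \<one> "x (2 * k)" w] dist_sym[of w \<one>] by simp
  qed
  have 2: "gp (g \<otimes> w) (x (- (2 * int n))) (x (2 * int n)) \<le> C' + 2 * C + 2 * \<delta>"
    using 1 far[of "int n"] far[of "- int n"] moved[of "int n"] moved[of "- int n"] n
    by (intro gp_far_endpoints[OF 1]) auto
  have "- (2 * int n) < 2 * int n" using ni(3) by simp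
  then obtain j where "gp (g \<otimes> w) (x j) (x (j + 1)) \<le> 2 * (C' + 2 * C + 2 * \<delta>) + C + 2 * \<delta>"
    using quasi_line_passes[OF ql _ 2[unfolded x_def]] unfolding x_def by blast
  then show thesis by (intro that[of j]) (simp add: x_def)
qed

end

section \<open>Roots of the perturbed element\<close>

lemma pigeonhole_fibre:
  assumes "finite I" "f ` A \<subseteq> I" "card I * B < card A"
  obtains j where "j \<in> I" "B < card {k \<in> A. f k = j}"
proof -
  have "\<exists>j\<in>I. B < card {k \<in> A. f k = j}"
  proof (rule ccontr)
    assume "\<not> ?thesis"
    then have "(\<Sum>j\<in>I. card {k \<in> A. f k = j}) \<le> card I * B"
      using sum_bounded_above[of I "\<lambda>j. card {k \<in> A. f k = j}" B] by (simp add: not_less)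
    moreover have "A = (\<Union>j\<in>I. {k \<in> A. f k = j})" using assms(2) by auto
    then have "card A \<le> (\<Sum>j\<in>I. card {k \<in> A. f k = j})" using card_UN_le[OF assms(1)] by metis
    ultimately show False using assms(3) by simp
  qed
  then show thesis using that by blast
qed

locale shortest_setting = gromov_group G S \<delta> for G (structure) and S \<delta> +
  fixes X :: "'a set" and N :: "'a set" and a :: 'a and C\<^sub>a :: real
  assumes marked: "marked_group G X" and N: "N \<lhd> G" and a: "a \<in> N" and inf: "infinite_order G a"
    and a_line: "quasi_line (\<lambda>i. a [^] (i::int)) C\<^sub>a"
begin

lemma a_G [simp, intro]: "a \<in> carrier G"
  using subgroup.mem_carrier[OF normal_imp_subgroup[OF N] a] .

lemma same_coset:
  assumes "v \<in> carrier G"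
  shows "(v \<otimes> a [^] (i::int)) \<otimes> inv (v \<otimes> a [^] (j::int)) \<in> N"
proof -
  have "a [^] (i - j) \<in> N"
    using subgroup_int_pow_closed[OF normal_imp_subgroup[OF N] a] .
  then have "v \<otimes> a [^] (i - j) \<otimes> inv v \<in> N" by (rule normal_left_right[OF N assms])
  then show ?thesis using assms by (simp add: int_pow_diff group_word_simps)
qed

lemma near_translate_bounded:
  obtains F where "\<And>h v y y' i j. \<lbrakk>shortest_mod X N h; v \<in> carrier G; y \<in> carrier G; y' \<in> carrier G;
     gp y \<one> h \<le> C; gp y' \<one> h \<le> C; wdist y (v \<otimes> a [^] (i::int)) \<le> C; wdist y' (v \<otimes> a [^] (j::int)) \<le> C\<rbrakk>
     \<Longrightarrow> wdist y y' \<le> F"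
proof -
  obtain F where F: "\<And>h y y' z z'. \<lbrakk>shortest_mod X N h; y \<in> carrier G; y' \<in> carrier G;
     gp y \<one> h \<le> C; gp y' \<one> h \<le> C; z \<in> carrier G; z' \<in> carrier G; z \<otimes> inv z' \<in> N;
     wdist y z \<le> C; wdist y' z' \<le> C\<rbrakk> \<Longrightarrow> wdist y y' \<le> F"
    using shortest_mod_near_coset_bounded[OF marked N, of C] by blast
  show thesis
  proof (rule that[of F])
    fix h v y y' and i j :: int
    assume "shortest_mod X N h" "v \<in> carrier G" "y \<in> carrier G" "y' \<in> carrier G"
     "gp y \<one> h \<le> C" "gp y' \<one> h \<le> C" "wdist y (v \<otimes> a [^] i) \<le> C" "wdist y' (v \<otimes> a [^] j) \<le> C"
    then show "wdist y y' \<le> F"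
      using F[of h y y' "v \<otimes> a [^] i" "v \<otimes> a [^] j"] same_coset[of v i j] by auto
  qed
qed

text \<open>If the product is large, the geodesics from \<open>1\<close> to \<open>h\<close> and to \<open>a\<^sup>m\<close> run together up to a point \<open>y\<close> far
  from \<open>1\<close>, and both \<open>1\<close> and \<open>y\<close> are near \<open>\<langle>a\<rangle>\<close>.\<close>

lemma gp_shortest_power:
  obtains C where "0 \<le> C" "\<And>h (m::int). shortest_mod X N h \<Longrightarrow> gp \<one> h (a [^] m) \<le> C"
proof -
  define D where "D = 4 * \<delta> + C\<^sub>a + wdist \<one> a"
  have "0 \<le> D" using delta_nonneg quasi_line_nonneg[OF a_line] dist_nonneg[of \<one> a] by (simp add: D_def)
  obtain F where F: "\<And>h v y y' i j. \<lbrakk>shortest_mod X N h; v \<in> carrier G; y \<in> carrier G; y' \<in> carrier G;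
     gp y \<one> h \<le> D; gp y' \<one> h \<le> D; wdist y (v \<otimes> a [^] (i::int)) \<le> D; wdist y' (v \<otimes> a [^] (j::int)) \<le> D\<rbrakk>
     \<Longrightarrow> wdist y y' \<le> F"
    using near_translate_bounded[of D] by blast
  show thesis
  proof (rule that[of "max 0 (F + 1)"])
    fix h and m :: int assume h: "shortest_mod X N h"
    then have [simp]: "h \<in> carrier G" by (simp add: shortest_mod_def)
    define \<rho> where "\<rho> = gp \<one> h (a [^] m)"
    define r where "r = nat \<lfloor>\<rho>\<rfloor>"
    have "0 \<le> \<rho>" unfolding \<rho>_def by (rule gp_nonneg)
    then have r: "real r \<le> \<rho>" "\<rho> \<le> real r + 1" unfolding r_def by linarith+
    obtain \<gamma> n where \<gamma>: "\<gamma> 0 = \<one>" "\<gamma> n = h" "\<And>i. \<gamma> i \<in> carrier G" "wdist \<one> h = real n"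
      "\<And>i j. i \<le> j \<Longrightarrow> j \<le> n \<Longrightarrow> wdist (\<gamma> i) (\<gamma> j) = real (j - i)"
      using geodesic_dist[of h] by auto
    have "r \<le> n" using r(1) gp_le_dist[of \<one> h "a [^] m"] \<gamma>(4) unfolding \<rho>_def by linarith
    define y where "y = \<gamma> r"
    have [simp]: "y \<in> carrier G" by (simp add: y_def \<gamma>(3))
    have y: "wdist \<one> y = real r" "wdist y h = real (n - r)"
      using \<gamma>(5)[of 0 r] \<gamma>(5)[of r n] \<open>r \<le> n\<close> by (simp_all add: y_def \<gamma>(1,2))
    then have "gp y \<one> h = 0" using \<gamma>(4) dist_sym[of y \<one>] \<open>r \<le> n\<close> by (simp add: gp_def of_nat_diff)
    then have "gp y \<one> (a [^] m) \<le> \<delta>"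
      using y(1) r(1) by (intro gp_initial_segment[of y \<one> h]) (auto simp: \<rho>_def)
    then obtain l :: int where "wdist y (a [^] l) \<le> 2 * \<delta> + C\<^sub>a + 2 * \<delta> + wdist \<one> a"
      using near_power[OF a_G a_line, of y 0 m \<delta>] by auto
    then have "wdist y \<one> \<le> F"
      using F[of h \<one> y \<one> l 0] h \<open>gp y \<one> h = 0\<close> \<open>0 \<le> D\<close>
      by (simp add: gp_def dist_self D_def)
    then show "gp \<one> h (a [^] m) \<le> max 0 (F + 1)" using y(1) r(2) dist_sym[of y \<one>] unfolding \<rho>_def by linarith
  qed simp
qed

text \<open>Here \<open>y k\<close>, for \<open>k \<le> K\<close>, are the translates by \<open>g\<close> of the powers between \<open>a\<^sup>-\<^sup>K\<close> and \<open>1\<close>, which form one step of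
  the line of \<open>u = h a\<^sup>K\<close>, and \<open>J k\<close> is the index of a step of the line close to \<open>y k\<close>. The constant \<open>K\<close>
  is chosen first, so large that many \<open>y k\<close> share a step even if five different steps occur; the
  bound \<open>L\<close> on the length of \<open>h\<close> depends on \<open>K\<close> and ensures that there are no more than five.\<close>

lemma root_commensurates:
  assumes "0 \<le> C\<^sub>1"
    and turn: "\<And>h (m::int). shortest_mod X N h \<Longrightarrow> gp \<one> h (a [^] m) \<le> C\<^sub>1"
  obtains K :: nat and L where
    "\<And>h. shortest_mod X N h \<Longrightarrow> L < wdist \<one> h \<Longrightarrow> quasi_line (zigzag h (a [^] int K)) (C\<^sub>1 + 2 * \<delta>)"
    "\<And>h g. shortest_mod X N h \<Longrightarrow> L < wdist \<one> h \<Longrightarrow> g \<in> carrier G \<Longrightarrow>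
       g \<otimes> (h \<otimes> a [^] int K) = (h \<otimes> a [^] int K) \<otimes> g \<Longrightarrow>
       \<exists>(i::int) (n::int) (m::int). m \<noteq> 0 \<and>
         (inv g \<otimes> (h \<otimes> a [^] int K) [^] i) \<otimes> a [^] n = a [^] m \<otimes> (inv g \<otimes> (h \<otimes> a [^] int K) [^] i)"
proof -
  define C where "C = C\<^sub>1 + 2 * \<delta>"
  define C\<^sub>2 where "C\<^sub>2 = 2 * C\<^sub>a + 5 * C + 6 * \<delta>"
  define D where "D = 2 * C\<^sub>2 + C\<^sub>a + 2 * \<delta> + wdist \<one> a"
  have C0: "0 \<le> C" "C\<^sub>1 \<le> C" using assms(1) delta_nonneg by (simp_all add: C_def)
  have Ca0: "0 \<le> C\<^sub>a" by (rule quasi_line_nonneg[OF a_line])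
  have C20: "0 \<le> C\<^sub>2" using C0 Ca0 delta_nonneg by (simp add: C\<^sub>2_def)
  obtain F where F: "\<And>h v y y' i j. \<lbrakk>shortest_mod X N h; v \<in> carrier G; y \<in> carrier G; y' \<in> carrier G;
     gp y \<one> h \<le> C\<^sub>2; gp y' \<one> h \<le> C\<^sub>2; wdist y (v \<otimes> a [^] (i::int)) \<le> C\<^sub>2; wdist y' (v \<otimes> a [^] (j::int)) \<le> C\<^sub>2\<rbrakk>
     \<Longrightarrow> wdist y y' \<le> F"
    using near_translate_bounded[of C\<^sub>2] by blast
  define ball where "ball = {x \<in> carrier G. wdist \<one> x \<le> max F D}"
  define B where "B = card ball"
  have fin: "finite ball" unfolding ball_def by (rule finite_ball)
  obtain K where K: "5 * B \<le> K" "wdist \<one> (a [^] int K) > 2 * C + 1"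
    using infinite_order_unbounded[OF a_G inf, of "5 * B" "2 * C + 1"] by blast
  define b where "b = a [^] int K"
  define L where "L = 2 * C + 1 + real K * wdist \<one> a + 2 * C\<^sub>2 + 6 * C"
  have [simp]: "b \<in> carrier G" by (simp add: b_def)
  have L0: "2 * C + 1 \<le> L" using C0 C20 dist_nonneg[of \<one> a] by (simp add: L_def)
  have line: "quasi_line (zigzag h b) C" if h: "shortest_mod X N h" "L < wdist \<one> h" for h
  proof -
    interpret X: marked_group G X by (rule marked)
    have [simp]: "h \<in> carrier G" using h by (simp add: shortest_mod_def)
    have "gp \<one> (inv b) h \<le> C\<^sub>1"
      using turn[OF h(1), of "- int K"] gp_commute[of \<one> h] by (simp add: b_def int_pow_neg)
    moreover have "gp \<one> (inv h) b \<le> C\<^sub>1"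
      using turn[OF X.shortest_mod_inv[OF N h(1)]] by (simp add: b_def)
    ultimately show ?thesis
      unfolding C_def using h K(2) L0 delta_nonneg
      by (intro zigzag_quasi_line) (auto simp: C_def b_def)
  qed
  show thesis
  proof (rule that[of L K])
    fix h g assume h: "shortest_mod X N h" "L < wdist \<one> h" and [simp]: "g \<in> carrier G"
      and comm: "g \<otimes> (h \<otimes> a [^] int K) = (h \<otimes> a [^] int K) \<otimes> g"
    define u where "u = h \<otimes> b"
    have [simp]: "h \<in> carrier G" using h by (simp add: shortest_mod_def)
    have [simp]: "u \<in> carrier G" by (simp add: u_def)
    define x where "x = zigzag h b"
    note ql = line[OF h, folded x_def]
    have x: "x (2 * i) = u [^] i" "x (2 * i + 1) = u [^] i \<otimes> h" for i
      by (simp_all add: x_def u_def zigzag_even_odd)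
    define y where "y k = g \<otimes> a [^] (- int k)" for k
    have [simp]: "y k \<in> carrier G" for k by (simp add: y_def)
    have y_dist: "wdist (y k) (y k') \<le> real K * wdist \<one> a" if "k \<le> K" "k' \<le> K" for k k'
    proof -
      have "wdist (y k) (y k') = wdist (a [^] (- int k)) (a [^] (- int k'))" by (simp add: y_def)
      also have "\<dots> \<le> real_of_int \<bar>- int k - - int k'\<bar> * wdist \<one> a" by (rule dist_pow_le) simp
      also have "\<dots> \<le> real K * wdist \<one> a" using that by (intro mult_right_mono dist_nonneg) auto
      finally show ?thesis .
    qed
    have "\<exists>j. gp (y k) (x j) (x (j + 1)) \<le> C\<^sub>2" if "k \<le> K" for k
    proof -
      have "u [^] (-1 :: int) \<otimes> h = inv b" by (simp add: int_pow_neg u_def group_word_simps)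
      then have "x (-1) = a [^] (- int K)" "x 0 = a [^] (0::int)"
        using x(2)[of "-1"] x(1)[of 0] by (simp_all add: b_def int_pow_neg)
      moreover have "gp (a [^] (- int k)) (a [^] (- int K)) (a [^] (0::int)) \<le> C\<^sub>a"
        using that by (intro quasi_lineD[OF a_line]) auto
      ultimately have w: "gp (a [^] (- int k)) (zigzag h b (-1)) (zigzag h b (-1 + 1)) \<le> C\<^sub>a"
        by (simp add: x_def)
      have "wdist \<one> h \<ge> 2 * C + 1" "wdist \<one> b \<ge> 2 * C + 1" using h(2) L0 K(2) by (simp_all add: b_def)
      then show ?thesis
        using commuting_preserves_zigzag[OF _ _ _ _ comm[folded b_def] line[OF h] _ _ w]
        by (auto simp: y_def x_def C\<^sub>2_def)
    qed
    then obtain J where J: "\<And>k. k \<le> K \<Longrightarrow> gp (y k) (x (J k)) (x (J k + 1)) \<le> C\<^sub>2" by metis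
    (* Three indices further on, a whole step of type h would lie between y k and y k', which are too
       close to each other for that. *)
    have J_close: "J k' < J k + 3" if k: "k \<le> K" "k' \<le> K" for k k'
    proof (rule ccontr)
      assume neg: "\<not> J k' < J k + 3"
      obtain e where e: "even e" "J k + 1 \<le> e" "e + 1 \<le> J k'"
      proof (cases "even (J k)")
        case True then show ?thesis using neg by (intro that[of "J k + 2"]) auto
      next
        case False then show ?thesis using neg by (intro that[of "J k + 1"]) auto
      qed
      have "wdist \<one> h = wdist (x e) (x (e + 1))" using e(1) by (simp add: x_def wdist_zigzag)
      also have "\<dots> \<le> wdist (x (J k + 1)) (x (J k')) + 4 * C"
        using quasi_line_inner_dist[OF ql e(2) _ e(3)] by simp
      also have "wdist (x (J k + 1)) (x (J k')) \<le> wdist (y k) (y k') + 2 * C\<^sub>2 + 2 * C"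
        using neg by (intro quasi_line_separates[OF ql _ _ _ J[OF k(1)] J[OF k(2)]]) auto
      also have "wdist (y k) (y k') \<le> real K * wdist \<one> a" by (rule y_dist[OF k])
      finally show False using h(2) C0 by (simp add: L_def)
    qed
    have "J ` {..K} \<subseteq> {J 0 - 2..J 0 + 2}" using J_close[of 0] J_close[of _ 0] by force
    then obtain j where j: "B < card {k \<in> {..K}. J k = j}"
      using pigeonhole_fibre[of "{J 0 - 2..J 0 + 2}" J "{..K}" B] K(1) by auto
    define A where "A = {k \<in> {..K}. J k = j}"
    have A: "gp (y k) (x j) (x (j + 1)) \<le> C\<^sub>2" if "k \<in> A" for k
      using that J[of k] by (auto simp: A_def)
    (* Neither the differences of the points y k nor their deviations from powers of a can all be
       different elements of the ball. *)
    have crowded: "\<not> (inj_on f A \<and> f ` A \<subseteq> ball)" for f :: "nat \<Rightarrow> 'a"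
      using card_inj_on_le[OF _ _ fin, of f A] j unfolding B_def A_def by auto
    (* An even step is a translate of the step from \<one> to h, where only few of the points y k, which
       all lie in one translate of the powers of a, can be. *)
    have "odd j"
    proof
      assume "even j"
      then obtain i where i: "j = 2 * i" by blast
      have "A \<noteq> {}" using j by (metis A_def card.empty not_less_zero)
      then obtain k\<^sub>0 where k0: "k\<^sub>0 \<in> A" by blast
      define v where "v = inv (u [^] i) \<otimes> g"
      have [simp]: "v \<in> carrier G" by (simp add: v_def)
      have on_h: "gp (v \<otimes> a [^] (- int k)) \<one> h \<le> C\<^sub>2" if "k \<in> A" for k
      proof -
        have "gp (v \<otimes> a [^] (- int k)) \<one> h = gp (u [^] i \<otimes> (v \<otimes> a [^] (- int k))) (u [^] i \<otimes> \<one>) (u [^] i \<otimes> h)"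
          by (subst gp_left_mult) auto
        also have "u [^] i \<otimes> (v \<otimes> a [^] (- int k)) = y k" by (simp add: v_def y_def m_assoc)
        finally show ?thesis using A[OF that] x[of i] by (simp add: i)
      qed
      have "wdist \<one> (a [^] (int k\<^sub>0 - int k)) \<le> F" if "k \<in> A" for k
      proof -
        have "wdist (v \<otimes> a [^] (- int k\<^sub>0)) (v \<otimes> a [^] (- int k)) \<le> F"
          using on_h[OF k0] on_h[OF that] C20
          by (intro F[OF h(1), of v _ _ "- int k\<^sub>0" "- int k"]) (simp_all add: dist_self del: dist_left_mult)
        moreover have "wdist (a [^] (- int k\<^sub>0)) (a [^] (- int k)) = wdist (a [^] int k\<^sub>0 \<otimes> a [^] (- int k\<^sub>0)) (a [^] int k\<^sub>0 \<otimes> a [^] (- int k))"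
          by (rule dist_left_mult[symmetric]) auto
        ultimately show ?thesis by (simp add: int_pow_neg int_pow_diff)
      qed
      moreover have "inj_on (\<lambda>k. a [^] (int k\<^sub>0 - int k)) A"
        using infinite_order_int_pow_eq[OF a_G inf] by (intro inj_onI) fastforce
      ultimately show False using crowded[of "\<lambda>k. a [^] (int k\<^sub>0 - int k)"] by (auto simp: ball_def le_max_iff_disj)
    qed
    then obtain i where i: "j = 2 * i + 1" by (rule oddE)
    (* An odd step is a translate of the step from a^(-K) to \<one>, which follows the powers of a. *)
    define e where "e = inv g \<otimes> u [^] (i + 1)"
    have [simp]: "e \<in> carrier G" by (simp add: e_def)
    have "\<exists>l::int. a [^] int k \<otimes> e \<otimes> a [^] l \<in> ball" if k: "k \<in> A" for k
    proof -
      define w where "w = inv e \<otimes> a [^] (- int k)"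
      have [simp]: "w \<in> carrier G" by (simp add: w_def)
      have "gp w (a [^] (- int K)) (a [^] (0::int)) =
         gp (u [^] (i + 1) \<otimes> w) (u [^] (i + 1) \<otimes> a [^] (- int K)) (u [^] (i + 1) \<otimes> a [^] (0::int))"
        by (subst gp_left_mult) auto
      also have "u [^] (i + 1) \<otimes> w = y k" by (simp add: w_def e_def y_def group_word_simps)
      also have "u [^] (i + 1) \<otimes> a [^] (- int K) = x j"
        using x(2)[of i] by (simp add: i int_pow_mult int_pow_neg u_def b_def m_assoc)
      also have "u [^] (i + 1) \<otimes> a [^] (0::int) = x (j + 1)"
        using x(1)[of "i + 1"] by (simp add: i algebra_simps)
      finally have "gp w (a [^] (- int K)) (a [^] (0::int)) \<le> C\<^sub>2" using A[OF k] by simp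
      then obtain l :: int where "wdist w (a [^] l) \<le> D"
        using near_power[OF a_G a_line] unfolding D_def by blast
      moreover have "wdist w (a [^] l) = wdist \<one> (a [^] int k \<otimes> e \<otimes> a [^] l)"
        by (simp add: wdist_eq w_def int_pow_neg group_word_simps)
      ultimately show ?thesis by (intro exI[of _ l]) (simp add: ball_def)
    qed
    then obtain l :: "nat \<Rightarrow> int" where "\<And>k. k \<in> A \<Longrightarrow> a [^] int k \<otimes> e \<otimes> a [^] l k \<in> ball" by metis
    then have "\<not> inj_on (\<lambda>k. a [^] int k \<otimes> e \<otimes> a [^] l k) A" using crowded by blast
    then obtain k k' where kk: "a [^] int k \<otimes> e \<otimes> a [^] l k = a [^] int k' \<otimes> e \<otimes> a [^] l k'" "k \<noteq> k'"
      by (auto simp: inj_on_def)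
    have "inv (a [^] int k') \<otimes> (a [^] int k \<otimes> e \<otimes> a [^] l k) \<otimes> inv (a [^] l k) =
        inv (a [^] int k') \<otimes> (a [^] int k' \<otimes> e \<otimes> a [^] l k') \<otimes> inv (a [^] l k)"
      using kk(1) by simp
    then have "a [^] (int k - int k') \<otimes> e = e \<otimes> a [^] (l k' - l k)"
    proof -
      have "a [^] (int k - int k') = inv (a [^] int k') \<otimes> a [^] int k"
        using int_pow_mult[OF a_G, of "- int k'" "int k"] by (simp add: int_pow_neg)
      then show ?thesis
        using \<open>inv (a [^] int k') \<otimes> (a [^] int k \<otimes> e \<otimes> a [^] l k) \<otimes> inv (a [^] l k) = _\<close>
        by (simp add: int_pow_diff m_assoc)
    qed
    then show "\<exists>(i::int) (n::int) (m::int). m \<noteq> 0 \<and>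
         (inv g \<otimes> (h \<otimes> a [^] int K) [^] i) \<otimes> a [^] n = a [^] m \<otimes> (inv g \<otimes> (h \<otimes> a [^] int K) [^] i)"
      using kk(2) unfolding e_def u_def b_def
      by (intro exI[of _ "i + 1"] exI[of _ "l k' - l k"] exI[of _ "int k - int k'"]) simp
  qed (use line in \<open>simp add: b_def C_def\<close>)
qed

text \<open>An exponent \<open>p \<ge> 2\<close> enters only through \<open>p i - 1 \<noteq> 0\<close>: the commensurating element \<open>g\<^sup>-\<^sup>1 u\<^sup>i\<close> of
  \<open>root_commensurates\<close> is then a nontrivial power of the root \<open>g\<close>, so that a power of \<open>u\<close> itself
  commensurates \<open>\<langle>a\<rangle>\<close>.\<close>

lemma perturbed_not_proper_power:
  obtains K :: nat and L where
    "\<And>h. shortest_mod X N h \<Longrightarrow> L < wdist \<one> h \<Longrightarrow> \<not> proper_power G (h \<otimes> a [^] int K)"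
proof -
  obtain C\<^sub>1 where C1: "0 \<le> C\<^sub>1" "\<And>h (m::int). shortest_mod X N h \<Longrightarrow> gp \<one> h (a [^] m) \<le> C\<^sub>1"
    using gp_shortest_power by blast
  define C where "C = C\<^sub>1 + 2 * \<delta>"
  obtain K :: nat and L where line:
    "\<And>h. shortest_mod X N h \<Longrightarrow> L < wdist \<one> h \<Longrightarrow> quasi_line (zigzag h (a [^] int K)) C" and comm:
    "\<And>h g. shortest_mod X N h \<Longrightarrow> L < wdist \<one> h \<Longrightarrow> g \<in> carrier G \<Longrightarrow>
       g \<otimes> (h \<otimes> a [^] int K) = (h \<otimes> a [^] int K) \<otimes> g \<Longrightarrow>
       \<exists>(i::int) (n::int) (m::int). m \<noteq> 0 \<and>
         (inv g \<otimes> (h \<otimes> a [^] int K) [^] i) \<otimes> a [^] n = a [^] m \<otimes> (inv g \<otimes> (h \<otimes> a [^] int K) [^] i)"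
    using root_commensurates[OF C1] unfolding C_def by metis
  define D where "D = 2 * (C + (3 * C\<^sub>a + 6 * \<delta> + wdist \<one> a)) + C\<^sub>a + 2 * \<delta> + wdist \<one> a"
  have D0: "0 \<le> D"
    using C1(1) quasi_line_nonneg[OF a_line] dist_nonneg[of \<one> a] delta_nonneg by (simp add: D_def C_def)
  obtain F where F: "\<And>h v y y' i j. \<lbrakk>shortest_mod X N h; v \<in> carrier G; y \<in> carrier G; y' \<in> carrier G;
     gp y \<one> h \<le> D; gp y' \<one> h \<le> D; wdist y (v \<otimes> a [^] (i::int)) \<le> D; wdist y' (v \<otimes> a [^] (j::int)) \<le> D\<rbrakk>
     \<Longrightarrow> wdist y y' \<le> F"
    using near_translate_bounded[of D] by blast
  show thesis
  proof (rule that[of "max L F" K], rule notI)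
    fix h assume h: "shortest_mod X N h" "max L F < wdist \<one> h"
      and "proper_power G (h \<otimes> a [^] int K)"
    define u where "u = h \<otimes> a [^] int K"
    have [simp]: "h \<in> carrier G" using h by (simp add: shortest_mod_def)
    have [simp]: "u \<in> carrier G" by (simp add: u_def)
    obtain g p where g [simp]: "g \<in> carrier G" and p: "(p::int) \<ge> 2" "u = g [^] p"
      using \<open>proper_power G _\<close> by (auto simp: proper_power_def u_def)
    have "g \<otimes> u = u \<otimes> g"
      using int_pow_mult[OF g, of 1 p] int_pow_mult[OF g, of p 1] by (simp add: p(2) add.commute)
    then obtain i n m :: int where inm: "m \<noteq> 0"
      "(inv g \<otimes> u [^] i) \<otimes> a [^] n = a [^] m \<otimes> (inv g \<otimes> u [^] i)"
      using comm[OF h(1) _ g] h(2) unfolding u_def by auto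
    define q where "q = p * i - 1"
    have "q \<noteq> 0"
    proof
      assume "q = 0"
      then have "p dvd 1" by (intro dvdI[of _ _ i]) (simp add: q_def)
      then show False using p(1) by simp
    qed
    have e: "inv g \<otimes> u [^] i = g [^] q"
      using int_pow_mult[OF g, of "-1" "p * i"] by (simp add: q_def p(2) int_pow_pow int_pow_neg)
    define r where "r = nat p"
    have "(g [^] q) [^] r = u [^] q"
      using p(1) int_pow_pow[OF g, of q p] int_pow_pow[OF g, of p q]
      by (simp add: r_def p(2) mult.commute flip: int_pow_int)
    then have uq: "u [^] q \<otimes> a [^] (n ^ r) = a [^] (m ^ r) \<otimes> u [^] q"
      using intertwine_iterate[OF int_pow_closed[OF g] a_G, of q n m r] inm(2) by (simp add: e)
    (* A positive exponent is wanted, so that h lies between \<one> and the power of u on the line. *)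
    obtain s :: nat and n' m' :: int where s: "0 < s" "m' \<noteq> 0"
      "u [^] int s \<otimes> a [^] n' = a [^] m' \<otimes> u [^] int s"
    proof (cases "0 < q")
      case True
      then show ?thesis using that[of "nat q" "m ^ r" "n ^ r"] uq inm(1) by simp
    next
      case False
      have "inv (u [^] q) \<otimes> (u [^] q \<otimes> a [^] (n ^ r)) \<otimes> inv (u [^] q) =
          inv (u [^] q) \<otimes> (a [^] (m ^ r) \<otimes> u [^] q) \<otimes> inv (u [^] q)"
        by (simp only: uq)
      then have "a [^] (n ^ r) \<otimes> inv (u [^] q) = inv (u [^] q) \<otimes> a [^] (m ^ r)"
        by (simp add: m_assoc)
      then have "u [^] int (nat (- q)) \<otimes> a [^] (m ^ r) = a [^] (n ^ r) \<otimes> u [^] int (nat (- q))"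
        using False by (simp add: int_pow_neg)
      moreover have "n ^ r \<noteq> 0"
        using intertwine_nonzero[OF a_G inf _ uq] inm(1) by simp
      ultimately show ?thesis using that[of "nat (- q)" "n ^ r" "m ^ r"] False \<open>q \<noteq> 0\<close> by simp
    qed
    obtain l :: int where l: "wdist (u [^] int s) (a [^] l) \<le> 3 * C\<^sub>a + 6 * \<delta> + wdist \<one> a"
      using commensurating_near_power[OF a_G inf a_line _ s(3,2)] by auto
    have "gp h \<one> (u [^] int s) \<le> C"
      using quasi_lineD[OF line[OF h(1)], of 0 1 "2 * int s"] h(2) s(1)
        zigzag_even_odd[of h "a [^] int K" 0] zigzag_even_odd(1)[of h "a [^] int K" "int s"]
      by (simp add: u_def)
    then have "gp h (a [^] (0::int)) (a [^] l) \<le> C + (3 * C\<^sub>a + 6 * \<delta> + wdist \<one> a)"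
      using gp_move_right[of h \<one> "a [^] l" "u [^] int s"] l by simp
    then obtain l' :: int where "wdist h (a [^] l') \<le> D"
      using near_power[OF a_G a_line] unfolding D_def by blast
    then have "wdist h \<one> \<le> F"
      using F[OF h(1), of \<one> h \<one> l' 0] D0 by (simp add: gp_def dist_self dist_sym)
    then show False using h(2) dist_sym[of h \<one>] by simp
  qed
qed

end

section \<open>Lengths in the quotient\<close>

lemma (in group) normal_closure_normal:
  assumes "a \<in> carrier G"
  shows "normal_closure G a \<lhd> G" and "a \<in> normal_closure G a"
proof -
  show "normal_closure G a \<lhd> G"
  proof (rule iffD2[OF normal_inv_iff], intro conjI ballI)
    show "subgroup (normal_closure G a) G"
      unfolding normal_closure_def using normal_self assms
      by (intro subgroups_Inter) (auto intro: normal_imp_subgroup)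
    fix x h assume "x \<in> carrier G" "h \<in> normal_closure G a"
    then show "x \<otimes> h \<otimes> inv x \<in> normal_closure G a"
      by (auto simp: normal_closure_def normal_left_right)
  qed
  show "a \<in> normal_closure G a" by (simp add: normal_closure_def)
qed

text \<open>A word for any element of the coset of \<open>h\<close> maps to a word for that coset. So an element whose
  length equals the length of its coset is shortest in it, which is the only way in which the
  quotient metric enters.\<close>

lemma (in marked_group) quotient_length_le:
  assumes a: "a \<in> carrier G" and h: "h \<in> carrier G" and x: "x \<in> normal_closure G a"
  shows "quotient_length G X a h \<le> wlen X (h \<otimes> x)"
proof -
  define N where "N = normal_closure G a"
  have NG: "N \<lhd> G" unfolding N_def by (rule normal_closure_normal[OF a])
  interpret N: normal N G by (rule NG)
  interpret Q: group "G Mod N" by (rule N.factorgroup_is_group)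
  define \<pi> where "\<pi> x = x <# N" for x
  have xG: "x \<in> carrier G" using x N.subset by (auto simp: N_def)
  have \<pi>_r: "\<pi> y = N #> y" if "y \<in> carrier G" for y using N.coset_eq that by (simp add: \<pi>_def)
  have "(\<lambda>y. N #> y) \<in> hom G (G Mod N)" by (rule N.r_coset_hom_Mod)
  then have "\<pi> \<in> hom G (G Mod N)" using \<pi>_r by (auto simp: hom_def Pi_iff)
  then interpret \<pi>: group_hom G "G Mod N" \<pi> by unfold_locales
  have val: "word_value (G Mod N) (map \<pi> w) = \<pi> (word_value G w)" if "set w \<subseteq> carrier G" for w
    using that by (induction w) (simp_all del: mult_FactGroup)
  obtain w where w: "length w = wlen X (h \<otimes> x)" "set w \<subseteq> letters" "word_value G w = h \<otimes> x"
    using shortest_word[of "h \<otimes> x"] h xG by blast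
  have "set w \<subseteq> carrier G" using w(2) letters_carrier by blast
  then have v: "word_value (G Mod N) (map \<pi> w) = \<pi> (h \<otimes> x)" using val w(3) by simp
  have "\<pi> (h \<otimes> x) = \<pi> h"
  proof -
    have "\<pi> x = \<one>\<^bsub>G Mod N\<^esub>" using x N.rcos_const xG by (simp add: \<pi>_r N_def)
    then show ?thesis using h xG \<pi>.hom_closed[of h] by (simp del: mult_FactGroup one_FactGroup)
  qed
  moreover have "inv\<^bsub>G Mod N\<^esub> N \<otimes>\<^bsub>G Mod N\<^esub> \<pi> h = \<pi> h"
    using Q.inv_one Q.l_one[OF \<pi>.hom_closed[OF h]] by simp
  ultimately have "word_value (G Mod N) (map \<pi> w) = inv\<^bsub>G Mod N\<^esub> N \<otimes>\<^bsub>G Mod N\<^esub> \<pi> h" using v by simp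
  moreover have "set (map \<pi> w) \<subseteq> \<pi> ` X \<union> m_inv (G Mod N) ` \<pi> ` X"
    using w(2) X_carrier \<pi>.hom_inv by (fastforce simp: image_iff)
  ultimately have "word_dist (G Mod N) (\<pi> ` X) N (\<pi> h) \<le> length w"
    unfolding word_dist_def by (intro Least_le exI[of _ "map \<pi> w"]) simp
  then show ?thesis using w(1) by (simp add: quotient_length_def N_def \<pi>_def[abs_def])
qed

theorem propositionD:
  fixes G :: "('a, 'b) monoid_scheme" and X :: "'a set"
  assumes "hyperbolic_group G" and "finite_generating_set G X"
  shows "\<forall>a\<in>carrier G. infinite_order G a \<longrightarrow>
    (\<exists>(K::int) (N::real). \<forall>h\<in>carrier G.
       word_dist G X \<one>\<^bsub>G\<^esub> h = quotient_length G X a h \<and>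
       real (quotient_length G X a h) > N \<longrightarrow>
       \<not> proper_power G (h \<otimes>\<^bsub>G\<^esub> a [^]\<^bsub>G\<^esub> K))"
proof (intro ballI impI)
  fix a assume a_carrier: "a \<in> carrier G" and a_inf: "infinite_order G a"
  obtain S \<delta> where S: "group G" "finite_generating_set G S"
    "\<forall>w\<in>carrier G. \<forall>x\<in>carrier G. \<forall>y\<in>carrier G. \<forall>z\<in>carrier G.
        gromov_product (\<lambda>g h. real (word_dist G S g h)) w x z \<ge>
          min (gromov_product (\<lambda>g h. real (word_dist G S g h)) w x y)
            (gromov_product (\<lambda>g h. real (word_dist G S g h)) w y z) - \<delta>"
    using assms(1) unfolding hyperbolic_group_def gromov_hyperbolic_on_def by blast
  interpret gromov_group G S \<delta>
    using S by (intro gromov_group.intro marked_group.intro marked_group_axioms.intro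
        gromov_group_axioms.intro) blast+
  interpret X: marked_group G X using assms(2) by unfold_locales
  obtain C where C: "quasi_line (\<lambda>i. a [^]\<^bsub>G\<^esub> (i::int)) C" using infinite_order_quasi_line[OF a_carrier a_inf] .
  define N where "N = normal_closure G a"
  interpret shortest_setting G S \<delta> X N a C
    using X.marked_group_axioms normal_closure_normal[OF a_carrier] a_inf C gromov_group_axioms
    by (simp add: shortest_setting_def shortest_setting_axioms_def N_def)
  obtain K :: nat and L where KL:
    "\<And>h. shortest_mod X N h \<Longrightarrow> L < wdist \<one>\<^bsub>G\<^esub> h \<Longrightarrow> \<not> proper_power G (h \<otimes>\<^bsub>G\<^esub> a [^]\<^bsub>G\<^esub> int K)"
    using perturbed_not_proper_power by blast
  obtain \<Lambda> where \<Lambda>: "1 \<le> \<Lambda>" "\<And>x. x \<in> carrier G \<Longrightarrow> real (wlen X x) \<le> \<Lambda> * real (wlen S x)"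
    using X.wlen_Lipschitz[OF marked_group_axioms] by blast
  show "\<exists>(K::int) (N::real). \<forall>h\<in>carrier G.
       word_dist G X \<one>\<^bsub>G\<^esub> h = quotient_length G X a h \<and>
       real (quotient_length G X a h) > N \<longrightarrow>
       \<not> proper_power G (h \<otimes>\<^bsub>G\<^esub> a [^]\<^bsub>G\<^esub> K)"
  proof (intro exI ballI impI)
    fix h assume h: "h \<in> carrier G" and
      len: "word_dist G X \<one>\<^bsub>G\<^esub> h = quotient_length G X a h \<and> real (quotient_length G X a h) > \<Lambda> * L"
    then have "shortest_mod X N h"
      using X.quotient_length_le[OF a_carrier h] by (simp add: shortest_mod_def wlen_def N_def)
    moreover have "\<Lambda> * L < \<Lambda> * wdist \<one>\<^bsub>G\<^esub> h"
      using len \<Lambda>(2)[OF h] h by (simp add: dist_one wlen_def)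
    then have "L < wdist \<one>\<^bsub>G\<^esub> h" using \<Lambda>(1) by simp
    ultimately show "\<not> proper_power G (h \<otimes>\<^bsub>G\<^esub> a [^]\<^bsub>G\<^esub> int K)" by (rule KL)
  qed
qed

end
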